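(* Let $G=(V,E)$ be a loopless multigraph with $n=|V|$, $m=|E|$, and let $k\in\mathbb{N}$. The algorithm described in the context (Algorithm 3) outputs every $k$-connected outdegree sequence of $G$ exactly once, with delay $O(knm^2)$.
   Context: For a digraph $D=(V,A)$ and $X\subseteq V$, $\delta^+_D(X)$ is the number of arcs leaving $X$; $\delta^+_D(v)=\delta^+_D(\{v\})$. $D$ is $k$-connected ($k$-arc-connected) if $\delta^+_D(X)\ge k$ for all $\emptyset\ne X\subsetneq V$. A function $\alpha:V\to\mathbb{N}$ is a $k$-connected outdegree sequence of $G$ if there is a $k$-connected orientation $D$ of $G$ with $\delta^+_D=\alpha$. $D^P$ is $D$ with the arcs of $P$ reversed. $\lambda_D(u,v)$ is the maximum number of pairwise arc-disjoint directed $u$–$v$ paths in $D$. In a $k$-connected $D$, a pair $(u,v)$ of distinct vertices is flippable if $\lambda_D(u,v)>k$. Procedures (with a fixed linear order on $V$): Reverse$^-(D,F,v)$: if there is $u\in V\setminus F$, $u\ne v$, with $(v,u)$ flippable in $D$, take a directed path $P$ from $v$ to $u$ in $D$, call Reverse$^-(D^P,F,v)$, then EnODS$(D^P,F\cup\{v\})$. Reverse$^+(D,F,v)$: if there is $u\in V\setminus F$, $u\ne v$, with $(u,v)$ flippable in $D$, take a directed path $P$ from $u$ to $v$, call Reverse$^+(D^P,F,v)$, then EnODS$(D^P,F\cup\{v\})$. EnODS$(D,F)$: if $F\ne V$, let $v$ be the smallest vertex in $V\setminus F$ and call Reverse$^-(D,F,v)$, Reverse$^+(D,F,v)$, EnODS$(D,F\cup\{v\})$;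 if $F=V$, output $\delta^+_D$. Algorithm 3: if $G$ has a $k$-connected orientation $D$ (found by a separate method in $O(k^3n^3+kn^2m)$ time), fix a linear order on $V$ and call EnODS$(D,\emptyset)$. Delay: maximum time between consecutive outputs, including before the first and after the last.
   Formalization: The delay bound is proved for k ≥ 1 and m ≥ 1 (otherwise knm² is 0), when G has a k-connected orientation or kn ≤ m; for graphs with m < kn and no such orientation (no outputs) the initial method's time may exceed O(knm²), so no delay is claimed there. *)

theory Defs
  imports Complex_Main "Graph_Theory.Arc_Walk"
begin

section \<open>Graphs, orientations, connectivity\<close>

text \<open>Undirected multigraphs; parallel edges are distinct elements of the edge set.\<close>

record ('v, 'e) multigraph =
  mverts :: "'v set"
  medges :: "'e set"
  ends :: "'e \<Rightarrow> 'v set"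

definition loopless_multigraph :: "('v, 'e) multigraph \<Rightarrow> bool" where
  "loopless_multigraph G \<longleftrightarrow>
     finite (mverts G) \<and> finite (medges G) \<and>
     (\<forall>e\<in>medges G. ends G e \<subseteq> mverts G \<and> card (ends G e) = 2)"

definition orientation_of :: "('v, 'e) multigraph \<Rightarrow> ('v, 'e) pre_digraph \<Rightarrow> bool" where
  "orientation_of G D \<longleftrightarrow>
     verts D = mverts G \<and> arcs D = medges G \<and>
     (\<forall>e\<in>medges G. {tail D e, head D e} = ends G e)"

definition outdeg_set :: "('v, 'e) pre_digraph \<Rightarrow> 'v set \<Rightarrow> nat" where
  "outdeg_set D X = card {e \<in> arcs D. tail D e \<in> X \<and> head D e \<notin> X}"

definition outdeg :: "('v, 'e) pre_digraph \<Rightarrow> 'v \<Rightarrow> nat" where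
  "outdeg D v = outdeg_set D {v}"

definition k_connected :: "nat \<Rightarrow> ('v, 'e) pre_digraph \<Rightarrow> bool" where
  "k_connected k D \<longleftrightarrow> (\<forall>X. X \<noteq> {} \<and> X \<subset> verts D \<longrightarrow> outdeg_set D X \<ge> k)"

text \<open>
  An outdegree sequence is a function on the whole vertex type. For an orientation \<open>D\<close> of \<open>G\<close>
  the function \<open>outdeg D\<close> vanishes outside \<open>mverts G\<close>, so two sequences are equal iff they agree
  on \<open>mverts G\<close>.
\<close>

definition k_connected_outdeg_seq :: "('v, 'e) multigraph \<Rightarrow> nat \<Rightarrow> ('v \<Rightarrow> nat) \<Rightarrow> bool" where
  "k_connected_outdeg_seq G k \<alpha> \<longleftrightarrow>
     (\<exists>D. orientation_of G D \<and> k_connected k D \<and> outdeg D = \<alpha>)"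

definition reverse_arcs :: "('v, 'e) pre_digraph \<Rightarrow> 'e list \<Rightarrow> ('v, 'e) pre_digraph" where
  "reverse_arcs D P =
     D\<lparr>tail := (\<lambda>e. if e \<in> set P then head D e else tail D e),
       head := (\<lambda>e. if e \<in> set P then tail D e else head D e)\<rparr>"

definition max_arc_disjoint_paths :: "('v, 'e) pre_digraph \<Rightarrow> 'v \<Rightarrow> 'v \<Rightarrow> nat" where
  "max_arc_disjoint_paths D u v =
     Max {card Ps | Ps. (\<forall>P\<in>Ps. pre_digraph.apath D u P v) \<and>
                        pairwise (\<lambda>P Q. set P \<inter> set Q = {}) Ps}"

definition flippable :: "nat \<Rightarrow> ('v, 'e) pre_digraph \<Rightarrow> 'v \<Rightarrow> 'v \<Rightarrow> bool" where
  "flippable k D u v \<longleftrightarrow>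
     u \<in> verts D \<and> v \<in> verts D \<and> u \<noteq> v \<and> max_arc_disjoint_paths D u v > k"


section \<open>The enumeration procedures\<close>

text \<open>
  Running time is counted on a unit-cost RAM. A subroutine returns its result together with the
  number of steps it has made; functions, sets and maps on vertices or arcs stand for arrays, with
  constant-time access, whereas initialising or copying such an array costs its length.
\<close>

type_synonym 'a timed = "'a \<times> nat"

text \<open>
  The input representation: \<open>vs\<close> lists the vertices in the fixed linear order (so that this order
  is arbitrary), and \<open>inc v\<close> lists the edges incident with \<open>v\<close>.
\<close>

definition adjacency_rep :: "('v, 'e) multigraph \<Rightarrow> 'v list \<Rightarrow> ('v \<Rightarrow> 'e list) \<Rightarrow> bool" where
  "adjacency_rep G vs inc \<longleftrightarrow>
     distinct vs \<and> set vs = mverts G \<and>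
     (\<forall>v\<in>mverts G. distinct (inc v) \<and> set (inc v) = {e \<in> medges G. v \<in> ends G e})"

definition smallest_outside :: "'v list \<Rightarrow> 'v set \<Rightarrow> 'v" where
  "smallest_outside vs F = hd (filter (\<lambda>v. v \<notin> F) vs)"

text \<open>A run is recorded as a sequence of blocks of steps and of outputs.\<close>

datatype 'a event = Work nat | Output 'a

fun outputs :: "'a event list \<Rightarrow> 'a list" where
  "outputs [] = []"
| "outputs (Work t # tr) = outputs tr"
| "outputs (Output a # tr) = a # outputs tr"

text \<open>
  \<open>gaps 0 tr\<close> lists the times before the first output, between consecutive outputs, and after the
  last output (for a run without outputs: the total time). The first argument accumulates the
  length of the current gap.
\<close>

fun gaps :: "nat \<Rightarrow> 'a event list \<Rightarrow> nat list" where
  "gaps g [] = [g]"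
| "gaps g (Work t # tr) = gaps (g + t) tr"
| "gaps g (Output a # tr) = g # gaps 0 tr"

definition delay :: "'a event list \<Rightarrow> nat" where
  "delay tr = Max (set (gaps 0 tr))"

text \<open>
  A search procedure resolves the choices in \<open>Reverse\<^sup>-\<close> (or \<open>Reverse\<^sup>+\<close>): given \<open>D\<close>, \<open>F\<close>, \<open>v\<close> it
  returns a suitable vertex \<open>u\<close> and a path, or \<open>None\<close> if there is no such \<open>u\<close>.
\<close>

type_synonym ('v, 'e) search =
  "('v, 'e) pre_digraph \<Rightarrow> 'v set \<Rightarrow> 'v \<Rightarrow> (('v \<times> 'e list) option) timed"

definition valid_search_minus ::
    "('v, 'e) multigraph \<Rightarrow> nat \<Rightarrow> ('v, 'e) search \<Rightarrow> bool" where
  "valid_search_minus G k srch \<longleftrightarrow>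
     (\<forall>D F v. orientation_of G D \<and> k_connected k D \<and> F \<subseteq> mverts G \<and> v \<in> mverts G - F \<longrightarrow>
        (case fst (srch D F v) of
           None \<Rightarrow> \<not> (\<exists>u\<in>mverts G - F. u \<noteq> v \<and> flippable k D v u)
         | Some (u, P) \<Rightarrow> u \<in> mverts G - F \<and> u \<noteq> v \<and> flippable k D v u \<and>
                          pre_digraph.apath D v P u))"

definition valid_search_plus ::
    "('v, 'e) multigraph \<Rightarrow> nat \<Rightarrow> ('v, 'e) search \<Rightarrow> bool" where
  "valid_search_plus G k srch \<longleftrightarrow>
     (\<forall>D F v. orientation_of G D \<and> k_connected k D \<and> F \<subseteq> mverts G \<and> v \<in> mverts G - F \<longrightarrow>
        (case fst (srch D F v) of
           None \<Rightarrow> \<not> (\<exists>u\<in>mverts G - F. u \<noteq> v \<and> flippable k D u v)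
         | Some (u, P) \<Rightarrow> u \<in> mverts G - F \<and> u \<noteq> v \<and> flippable k D u v \<and>
                          pre_digraph.apath D u P v))"

text \<open>Copying the arrays that describe \<open>D\<close>, then swapping tail and head along \<open>P\<close>.\<close>

definition reverse_path :: "('v, 'e) pre_digraph \<Rightarrow> 'e list \<Rightarrow> ('v, 'e) pre_digraph timed" where
  "reverse_path D P = (reverse_arcs D P, card (arcs D) + length P)"

text \<open>
  The predicates relate the arguments of a call to the record of its execution; a call that does
  not terminate has none. Besides the steps of its subroutines, a call is charged one step, and
  \<open>length vs\<close> steps for each of: finding the smallest vertex outside \<open>F\<close> (or that there is none),
  and forming a set \<open>insert v F\<close>. Writing an output takes \<open>length vs + card (arcs D)\<close> steps.
\<close>

inductive
  reverse_minus :: "'v list \<Rightarrow> ('v, 'e) search \<Rightarrow> ('v, 'e) search \<Rightarrow>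
    ('v, 'e) pre_digraph \<Rightarrow> 'v set \<Rightarrow> 'v \<Rightarrow> ('v \<Rightarrow> nat) event list \<Rightarrow> bool" and
  reverse_plus :: "'v list \<Rightarrow> ('v, 'e) search \<Rightarrow> ('v, 'e) search \<Rightarrow>
    ('v, 'e) pre_digraph \<Rightarrow> 'v set \<Rightarrow> 'v \<Rightarrow> ('v \<Rightarrow> nat) event list \<Rightarrow> bool" and
  en_ods :: "'v list \<Rightarrow> ('v, 'e) search \<Rightarrow> ('v, 'e) search \<Rightarrow>
    ('v, 'e) pre_digraph \<Rightarrow> 'v set \<Rightarrow> ('v \<Rightarrow> nat) event list \<Rightarrow> bool"
  for vs :: "'v list" and find_minus find_plus :: "('v, 'e) search"
where
  minus_none:
    "find_minus D F v = (None, t) \<Longrightarrow>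
     reverse_minus vs find_minus find_plus D F v [Work (1 + t)]"
| minus_some:
    "find_minus D F v = (Some (u, P), t) \<Longrightarrow>
     reverse_path D P = (D', t') \<Longrightarrow>
     reverse_minus vs find_minus find_plus D' F v tr1 \<Longrightarrow>
     en_ods vs find_minus find_plus D' (insert v F) tr2 \<Longrightarrow>
     reverse_minus vs find_minus find_plus D F v
       ([Work (1 + t + t')] @ tr1 @ [Work (length vs)] @ tr2)"
| plus_none:
    "find_plus D F v = (None, t) \<Longrightarrow>
     reverse_plus vs find_minus find_plus D F v [Work (1 + t)]"
| plus_some:
    "find_plus D F v = (Some (u, P), t) \<Longrightarrow>
     reverse_path D P = (D', t') \<Longrightarrow>
     reverse_plus vs find_minus find_plus D' F v tr1 \<Longrightarrow>
     en_ods vs find_minus find_plus D' (insert v F) tr2 \<Longrightarrow>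
     reverse_plus vs find_minus find_plus D F v
       ([Work (1 + t + t')] @ tr1 @ [Work (length vs)] @ tr2)"
| en_ods_recurse:
    "F \<noteq> verts D \<Longrightarrow>
     v = smallest_outside vs F \<Longrightarrow>
     reverse_minus vs find_minus find_plus D F v tr1 \<Longrightarrow>
     reverse_plus vs find_minus find_plus D F v tr2 \<Longrightarrow>
     en_ods vs find_minus find_plus D (insert v F) tr3 \<Longrightarrow>
     en_ods vs find_minus find_plus D F
       ([Work (1 + length vs)] @ tr1 @ tr2 @ [Work (length vs)] @ tr3)"
| en_ods_output:
    "F = verts D \<Longrightarrow>
     en_ods vs find_minus find_plus D F
       [Work (1 + length vs), Work (length vs + card (arcs D)), Output (outdeg D)]"

text \<open>The method that computes the initial orientation is represented by its timed result.\<close>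

definition valid_initial ::
    "('v, 'e) multigraph \<Rightarrow> nat \<Rightarrow> (('v, 'e) pre_digraph option) timed \<Rightarrow> bool" where
  "valid_initial G k init \<longleftrightarrow>
     (case fst init of
        None \<Rightarrow> \<not> (\<exists>D. orientation_of G D \<and> k_connected k D)
      | Some D \<Rightarrow> orientation_of G D \<and> k_connected k D)"

inductive algorithm3 :: "'v list \<Rightarrow> ('v, 'e) search \<Rightarrow> ('v, 'e) search \<Rightarrow>
    (('v, 'e) pre_digraph option) timed \<Rightarrow> ('v \<Rightarrow> nat) event list \<Rightarrow> bool"
where
  no_orientation: "algorithm3 vs find_minus find_plus (None, t) [Work (1 + t)]"
| orientation:
    "en_ods vs find_minus find_plus D {} tr \<Longrightarrow>
     algorithm3 vs find_minus find_plus (Some D, t) ([Work (1 + t + length vs)] @ tr)"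


section \<open>Implementation of the searches by augmenting paths\<close>

text \<open>
  Graph search from \<open>s\<close>: \<open>par x\<close> is the arc through which \<open>x \<noteq> s\<close> has been reached, and the list
  contains the vertices that have been reached but not yet processed. As no vertex is put on this
  list twice, \<open>length vs\<close> rounds of \<open>explore\<close> are sufficient.
\<close>

fun scan_arcs :: "('v, 'e) pre_digraph \<Rightarrow> 'v \<Rightarrow> 'v \<Rightarrow> 'e list \<Rightarrow> ('v \<rightharpoonup> 'e) \<Rightarrow> 'v list \<Rightarrow>
    (('v \<rightharpoonup> 'e) \<times> 'v list) timed" where
  "scan_arcs D s x [] par Q = ((par, Q), 1)"
| "scan_arcs D s x (e # es) par Q =
     (let (r, t) =
        (if tail D e = x \<and> head D e \<noteq> s \<and> par (head D e) = None
         then scan_arcs D s x es (par(head D e \<mapsto> e)) (head D e # Q)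
         else scan_arcs D s x es par Q)
      in (r, 1 + t))"

fun explore :: "('v \<Rightarrow> 'e list) \<Rightarrow> ('v, 'e) pre_digraph \<Rightarrow> 'v \<Rightarrow> nat \<Rightarrow> ('v \<rightharpoonup> 'e) \<Rightarrow> 'v list \<Rightarrow>
    ('v \<rightharpoonup> 'e) timed" where
  "explore inc D s 0 par Q = (par, 1)"
| "explore inc D s (Suc i) par [] = (par, 1)"
| "explore inc D s (Suc i) par (x # Q) =
     (let ((par', Q'), t) = scan_arcs D s x (inc x) par Q;
          (r, t') = explore inc D s i par' Q'
      in (r, 1 + t + t'))"

fun trace_back :: "('v, 'e) pre_digraph \<Rightarrow> 'v \<Rightarrow> ('v \<rightharpoonup> 'e) \<Rightarrow> nat \<Rightarrow> 'v \<Rightarrow> 'e list \<Rightarrow>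
    ('e list) timed" where
  "trace_back D s par 0 x P = (P, 1)"
| "trace_back D s par (Suc i) x P =
     (if x = s then (P, 1)
      else case par x of
             None \<Rightarrow> (P, 1)
           | Some e \<Rightarrow> (let (r, t) = trace_back D s par i (tail D e) (e # P) in (r, 1 + t)))"

definition find_path :: "'v list \<Rightarrow> ('v \<Rightarrow> 'e list) \<Rightarrow> ('v, 'e) pre_digraph \<Rightarrow> 'v \<Rightarrow> 'v \<Rightarrow>
    ('e list option) timed" where
  "find_path vs inc D s x =
     (let (par, t) = explore inc D s (length vs) Map.empty [s] in
      if par x = None then (None, 1 + length vs + t)
      else (let (P, t') = trace_back D s par (length vs) x []
            in (Some P, 1 + length vs + t + t')))"

text \<open>
  \<open>augment vs inc s x j D\<close> tests whether \<open>j\<close> times in a row a path from \<open>s\<close> to \<open>x\<close> can be found and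
  reversed. These are the augmentations of the Ford-Fulkerson method for unit capacities:
  reversing a path in \<open>D\<close> yields the residual digraph.
\<close>

fun augment :: "'v list \<Rightarrow> ('v \<Rightarrow> 'e list) \<Rightarrow> 'v \<Rightarrow> 'v \<Rightarrow> nat \<Rightarrow> ('v, 'e) pre_digraph \<Rightarrow>
    bool timed" where
  "augment vs inc s x 0 D = (True, 1)"
| "augment vs inc s x (Suc j) D =
     (case find_path vs inc D s x of
        (None, t) \<Rightarrow> (False, 1 + t)
      | (Some P, t) \<Rightarrow>
          (let (D', t') = reverse_path D P; (r, t'') = augment vs inc s x j D'
           in (r, 1 + t + t' + t'')))"

text \<open>
  The first candidate \<open>u\<close> outside \<open>F \<union> {v}\<close> whose associated pair \<open>pr u\<close> is flippable, with a path
  between the two vertices of this pair.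
\<close>

fun first_flippable :: "'v list \<Rightarrow> ('v \<Rightarrow> 'e list) \<Rightarrow> nat \<Rightarrow> ('v \<Rightarrow> 'v \<times> 'v) \<Rightarrow>
    ('v, 'e) pre_digraph \<Rightarrow> 'v set \<Rightarrow> 'v \<Rightarrow> 'v list \<Rightarrow> (('v \<times> 'e list) option) timed" where
  "first_flippable vs inc k pr D F v [] = (None, 1)"
| "first_flippable vs inc k pr D F v (u # us) =
     (if u \<in> F \<or> u = v
      then (let (r, t) = first_flippable vs inc k pr D F v us in (r, 1 + t))
      else
        (let (s, x) = pr u; (b, t) = augment vs inc s x (Suc k) D in
         if b
         then (let (p, t') = find_path vs inc D s x
               in (map_option (\<lambda>P. (u, P)) p, 1 + t + t'))
         else (let (r, t') = first_flippable vs inc k pr D F v us in (r, 1 + t + t'))))"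

definition search_minus :: "'v list \<Rightarrow> ('v \<Rightarrow> 'e list) \<Rightarrow> nat \<Rightarrow> ('v, 'e) search" where
  "search_minus vs inc k D F v = first_flippable vs inc k (\<lambda>u. (v, u)) D F v vs"

definition search_plus :: "'v list \<Rightarrow> ('v \<Rightarrow> 'e list) \<Rightarrow> nat \<Rightarrow> ('v, 'e) search" where
  "search_plus vs inc k D F v = first_flippable vs inc k (\<lambda>u. (u, v)) D F v vs"

end

theory Submission
  imports Defs
begin

text \<open>
  For an orientation the number of arcs leaving \<open>X\<close> equals the sum of the outdegrees over \<open>X\<close> minus
  the number of edges inside \<open>X\<close>. Hence \<open>k\<close>-connectivity and, by Menger's theorem, flippability are
  properties of the outdegree sequence, and reversing a path between a flippable pair moves one
  unit of outdegree and keeps \<open>k\<close>-connectivity.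

  Suppose \<open>\<alpha>\<close> and \<open>\<beta>\<close> are \<open>k\<close>-connected sequences that agree on \<open>F\<close> and differ at \<open>v\<close>. If no suitable
  pair were flippable at \<open>\<alpha>\<close>, every vertex outside \<open>F \<union> {v}\<close> would be separated from \<open>v\<close> by a tight cut.
  By submodularity the maximal tight sets avoiding \<open>v\<close> are disjoint; comparing \<open>\<alpha>\<close> and \<open>\<beta>\<close> on them
  contradicts that both sum up to the number of edges. So \<open>Reverse\<^sup>-\<close> and \<open>Reverse\<^sup>+\<close> reach exactly
  the sequences that agree on \<open>F\<close> and are smaller, respectively larger, at \<open>v\<close>.

  Every run of \<open>EnODS\<close> ends with an output, and at most \<open>deg v + 3\<close> searches are made at \<open>v\<close> before
  an output or a step to the next vertex. As the degrees sum up to \<open>2m\<close>, between two outputs there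
  are \<open>O(m)\<close> searches, each consisting of \<open>O(kn)\<close> augmentations in time \<open>O(m)\<close>.
\<close>

section \<open>Outdegrees of orientations\<close>

locale loopless_graph =
  fixes G :: "('v, 'e) multigraph"
  assumes loopless: "loopless_multigraph G"
begin

abbreviation "V \<equiv> mverts G"
abbreviation "E \<equiv> medges G"

lemma finite_V: "finite V" and finite_E: "finite E"
  and ends_subset: "e \<in> E \<Longrightarrow> ends G e \<subseteq> V" and card_ends: "e \<in> E \<Longrightarrow> card (ends G e) = 2"
  using loopless by (auto simp: loopless_multigraph_def)

context
  fixes D :: "('v, 'e) pre_digraph"
  assumes D: "orientation_of G D"
begin

lemma verts_orientation: "verts D = V" and arcs_orientation: "arcs D = E"
  and ends_orientation: "e \<in> E \<Longrightarrow> ends G e = {tail D e, head D e}"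
  using D by (auto simp: orientation_of_def)

lemma tail_neq_head: "e \<in> E \<Longrightarrow> tail D e \<noteq> head D e"
  using card_ends[of e] ends_orientation[of e] by auto

lemma tail_in_V: "e \<in> E \<Longrightarrow> tail D e \<in> V" and head_in_V: "e \<in> E \<Longrightarrow> head D e \<in> V"
  using ends_subset[of e] ends_orientation[of e] by auto

lemma fin_digraph_orientation: "fin_digraph D"
  by unfold_locales
    (use tail_in_V head_in_V finite_V finite_E
     in \<open>auto simp: verts_orientation arcs_orientation\<close>)

lemma orientation_reverse_arcs: "orientation_of G (reverse_arcs D P)"
  using D by (auto simp: orientation_of_def reverse_arcs_def insert_commute)

text \<open>Without loops the condition on the head in \<open>outdeg_set\<close> holds
  automatically.\<close>

lemma outdeg_eq_card: "outdeg D w = card {e \<in> E. tail D e = w}"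
proof -
  have "{e \<in> arcs D. tail D e \<in> {w} \<and> head D e \<notin> {w}} = {e \<in> E. tail D e = w}"
    using tail_neq_head by (force simp: arcs_orientation)
  thus ?thesis by (simp add: outdeg_def outdeg_set_def)
qed

lemma outdeg_eq_sum: "int (outdeg D w) = (\<Sum>e\<in>E. of_bool (tail D e = w))"
  by (simp add: outdeg_eq_card finite_E Int_def)

lemma outdeg_outside: "w \<notin> V \<Longrightarrow> outdeg D w = 0"
  using tail_in_V by (force simp: outdeg_eq_card card_eq_0_iff)

lemma outdeg_set_le_card: "outdeg_set D X \<le> card E"
  unfolding outdeg_set_def arcs_orientation by (intro card_mono finite_E) auto

text \<open>The number of arcs leaving \<open>X\<close> is thus determined by the outdegrees: the last summand
  does not depend on the orientation.\<close>

lemma sum_outdeg: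
  assumes "X \<subseteq> V"
  shows "(\<Sum>w\<in>X. outdeg D w) = outdeg_set D X + card {e \<in> E. ends G e \<subseteq> X}"
proof -
  have X: "finite X" using assms finite_V finite_subset by blast
  have "(\<Sum>w\<in>X. outdeg D w) = card (\<Union>w\<in>X. {e \<in> E. tail D e = w})"
    unfolding outdeg_eq_card using X finite_E by (subst card_UN_disjoint) auto
  also have "(\<Union>w\<in>X. {e \<in> E. tail D e = w}) =
      {e \<in> arcs D. tail D e \<in> X \<and> head D e \<notin> X} \<union> {e \<in> E. ends G e \<subseteq> X}"
    by (auto simp: arcs_orientation ends_orientation)
  also have "card \<dots> = outdeg_set D X + card {e \<in> E. ends G e \<subseteq> X}"
    unfolding outdeg_set_def
    by (intro card_Un_disjoint) (auto simp: arcs_orientation ends_orientation finite_E)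
  finally show ?thesis .
qed

lemma sum_outdeg_V: "(\<Sum>w\<in>V. outdeg D w) = card E"
proof -
  have "outdeg_set D V = 0" using head_in_V by (auto simp: outdeg_set_def arcs_orientation card_eq_0_iff)
  moreover have "{e \<in> E. ends G e \<subseteq> V} = E" using ends_subset by auto
  ultimately show ?thesis using sum_outdeg[of V] by simp
qed

text \<open>Only arcs of \<open>P\<close> change their tail, and the new tail is the old head.
  Integers are used because the change may be negative.\<close>

lemma outdeg_reverse_arcs:
  assumes "set P \<subseteq> E"
  shows "int (outdeg (reverse_arcs D P) w) =
    int (outdeg D w) + (\<Sum>e\<in>set P. of_bool (head D e = w) - of_bool (tail D e = w))"
proof -
  let ?R = "reverse_arcs D P"
  have split: "E = set P \<union> (E - set P)" using assms by auto
  have "int (outdeg ?R w) = (\<Sum>e\<in>E. of_bool (tail ?R e = w))"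
    by (rule loopless_graph.outdeg_eq_sum[OF loopless_graph_axioms orientation_reverse_arcs])
  also have "\<dots> = (\<Sum>e\<in>set P. of_bool (tail ?R e = w)) + (\<Sum>e\<in>E - set P. of_bool (tail ?R e = w))"
    by (subst split, rule sum.union_disjoint) (auto simp: finite_E)
  also have "\<dots> = (\<Sum>e\<in>set P. of_bool (head D e = w)) + (\<Sum>e\<in>E - set P. of_bool (tail D e = w))"
    by (intro arg_cong2[of _ _ _ _ "(+)"] sum.cong) (auto simp: reverse_arcs_def)
  also have "\<dots> = (\<Sum>e\<in>set P. of_bool (head D e = w) - of_bool (tail D e = w)) +
      ((\<Sum>e\<in>set P. of_bool (tail D e = w)) + (\<Sum>e\<in>E - set P. of_bool (tail D e = w)))"
    by (simp add: sum_subtractf)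
  also have "(\<Sum>e\<in>set P. of_bool (tail D e = w)) + (\<Sum>e\<in>E - set P. of_bool (tail D e = w)) =
      (\<Sum>e\<in>E. of_bool (tail D e = w) :: int)"
    using sum.subset_diff[OF assms finite_E, of "\<lambda>e. of_bool (tail D e = w) :: int"] by simp
  finally show ?thesis by (simp add: outdeg_eq_sum)
qed

end

end

section \<open>Paths, cuts and the effect of reversing a path\<close>

lemma (in pre_digraph) sum_cas:
  assumes "cas u P x" "distinct P"
  shows "(\<Sum>e\<in>set P. of_bool (head G e = w) - of_bool (tail G e = w)) =
    (of_bool (x = w) - of_bool (u = w) :: int)"
  using assms by (induction P arbitrary: u) auto

lemma (in pre_digraph) cas_crosses_cut:
  assumes "cas u P x" "u \<in> X" "x \<notin> X"
  shows "\<exists>e\<in>set P. tail G e \<in> X \<and> head G e \<notin> X"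
  using assms by (induction P arbitrary: u) auto

text \<open>The cut is the set of vertices reachable through \<open>R\<close>. With \<open>R\<close>
  all arcs this yields augmenting paths, with \<open>R\<close> the arcs of a flow it yields paths
  inside the flow.\<close>

lemma (in wf_digraph) apath_or_cut:
  assumes "u \<in> verts G" "R \<subseteq> arcs G"
  obtains P where "apath u P x" "set P \<subseteq> R"
  | X where "X \<subseteq> verts G" "u \<in> X" "x \<notin> X" "\<And>e. e \<in> R \<Longrightarrow> tail G e \<in> X \<Longrightarrow> head G e \<in> X"
proof (cases "\<exists>P. awalk u P x \<and> set P \<subseteq> R")
  case True
  then obtain P where "awalk u P x" "set P \<subseteq> R" by auto
  hence "apath u (awalk_to_apath P) x" "set (awalk_to_apath P) \<subseteq> R"
    using apath_awalk_to_apath awalk_to_apath_subset by blast+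
  thus ?thesis by (rule that(1))
next
  case False
  let ?X = "{y. \<exists>P. awalk u P y \<and> set P \<subseteq> R}"
  show ?thesis
  proof (rule that(2)[of ?X])
    show "u \<in> ?X" using assms by (auto intro!: exI[of _ "[]"] simp: awalk_Nil_iff)
    fix e assume e: "e \<in> R" "tail G e \<in> ?X"
    then obtain P where P: "awalk u P (tail G e)" "set P \<subseteq> R" by auto
    have "awalk u (P @ [e]) (head G e)"
      using P e assms by (intro awalk_appendI[OF P(1)] arc_implies_awalk) auto
    thus "head G e \<in> ?X" using P e by (intro CollectI exI[of _ "P @ [e]"]) auto
  qed (use False awalk_last_in_verts in auto)
qed

context loopless_graph
begin

context
  fixes D :: "('v, 'e) pre_digraph" and P u x
  assumes D: "orientation_of G D" and P: "pre_digraph.apath D u P x"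
begin

lemma apath_subset_edges: "set P \<subseteq> E"
  using P D by (auto simp: pre_digraph.apath_def pre_digraph.awalk_def arcs_orientation)

lemma distinct_apath: "distinct P"
proof -
  interpret fin_digraph D by (rule fin_digraph_orientation[OF D])
  show ?thesis using P distinct_verts_imp_distinct by (auto simp: apath_def)
qed

lemma apath_cas: "pre_digraph.cas D u P x"
  using P by (simp add: pre_digraph.apath_def pre_digraph.awalk_def)

text \<open>The sum over \<open>P\<close> telescopes (\<open>sum_cas\<close>), so only the ends of
  the path are affected.\<close>

lemma outdeg_reverse_apath:
  "int (outdeg (reverse_arcs D P) w) = int (outdeg D w) + of_bool (x = w) - of_bool (u = w)"
  by (simp add: outdeg_reverse_arcs[OF D apath_subset_edges]
      pre_digraph.sum_cas[OF apath_cas distinct_apath])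

end

text \<open>The edges inside \<open>X\<close> cancel, since their number depends on \<open>G\<close>
  alone.\<close>

lemma outdeg_set_diff:
  assumes "orientation_of G D" "orientation_of G D'" "X \<subseteq> V"
  shows "int (outdeg_set D X) - int (outdeg_set D' X) =
    (\<Sum>w\<in>X. int (outdeg D w) - int (outdeg D' w))"
proof -
  have "int (\<Sum>w\<in>X. outdeg D w) - int (\<Sum>w\<in>X. outdeg D' w) =
      int (outdeg_set D X) - int (outdeg_set D' X)"
    using assms by (simp add: sum_outdeg del: of_nat_sum)
  thus ?thesis by (simp add: sum_subtractf)
qed

lemma outdeg_set_reverse_apath:
  assumes "orientation_of G D" "pre_digraph.apath D u P x" "X \<subseteq> V"
  shows "int (outdeg_set (reverse_arcs D P) X) =
    int (outdeg_set D X) + of_bool (x \<in> X) - of_bool (u \<in> X)"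
proof -
  have "finite X" using assms finite_V finite_subset by blast
  have "int (outdeg_set (reverse_arcs D P) X) - int (outdeg_set D X) =
      (\<Sum>w\<in>X. of_bool (x = w) - of_bool (u = w))"
    using assms by (subst outdeg_set_diff)
      (auto intro!: orientation_reverse_arcs simp: outdeg_reverse_apath)
  also have "\<dots> = of_bool (x \<in> X) - of_bool (u \<in> X)"
    using \<open>finite X\<close> by (auto simp: sum_subtractf of_bool_def)
  finally show ?thesis by simp
qed

text \<open>Only cuts with \<open>u\<close> inside and \<open>x\<close> outside lose value, and they
  lose exactly one unit, however often \<open>P\<close> crosses them.\<close>

lemma k_connected_reverse_apath:
  assumes "orientation_of G D" "pre_digraph.apath D u P x" "k_connected k D"
    and cut: "\<And>X. X \<subseteq> V \<Longrightarrow> u \<in> X \<Longrightarrow> x \<notin> X \<Longrightarrow> k < outdeg_set D X"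
  shows "k_connected k (reverse_arcs D P)"
  unfolding k_connected_def
proof (intro allI impI)
  fix X assume X: "X \<noteq> {} \<and> X \<subset> verts (reverse_arcs D P)"
  hence X': "X \<noteq> {}" "X \<subset> V"
    using verts_orientation[OF orientation_reverse_arcs[OF assms(1)]] by auto
  hence "k \<le> outdeg_set D X" using assms(1,3) by (auto simp: k_connected_def verts_orientation)
  moreover have "int (outdeg_set (reverse_arcs D P) X) =
      int (outdeg_set D X) + of_bool (x \<in> X) - of_bool (u \<in> X)"
    using X' by (intro outdeg_set_reverse_apath assms) auto
  ultimately show "k \<le> outdeg_set (reverse_arcs D P) X"
    using cut[of X] X' by (cases "x \<in> X"; cases "u \<in> X") auto
qed

lemma cut_positive_apath:
  assumes D: "orientation_of G D" and "u \<in> V"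
    and "\<And>X. X \<subseteq> V \<Longrightarrow> u \<in> X \<Longrightarrow> x \<notin> X \<Longrightarrow> 0 < outdeg_set D X"
  shows "\<exists>P. pre_digraph.apath D u P x"
proof -
  interpret fin_digraph D by (rule fin_digraph_orientation[OF D])
  have "u \<in> verts D" using assms by (simp add: verts_orientation)
  then consider P where "apath u P x"
    | X where "X \<subseteq> V" "u \<in> X" "x \<notin> X" "\<And>e. e \<in> E \<Longrightarrow> tail D e \<in> X \<Longrightarrow> head D e \<in> X"
    by (rule apath_or_cut[of u "arcs D" x]) (auto simp: D verts_orientation arcs_orientation)
  thus ?thesis
  proof cases
    case 2
    hence "outdeg_set D X = 0" by (auto simp: outdeg_set_def arcs_orientation[OF D] card_eq_0_iff)
    thus ?thesis using assms(3)[of X] 2 by auto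
  qed auto
qed

section \<open>Menger's theorem\<close>

text \<open>Flow decomposition: the arcs on which \<open>D\<close> and \<open>D'\<close> differ form a flow of value \<open>j\<close> in \<open>D\<close>
  from \<open>u\<close> to \<open>x\<close>; undoing the reversal along one of its paths lowers the value by one.\<close>

lemma disjoint_apaths_of_flow:
  assumes "orientation_of G D" "u \<in> V" "u \<noteq> x" "orientation_of G D'"
    and "\<And>w. int (outdeg D w) - int (outdeg D' w) = int j * (of_bool (u = w) - of_bool (x = w))"
  shows "\<exists>Ps. finite Ps \<and> card Ps = j \<and> (\<forall>P\<in>Ps. pre_digraph.apath D u P x) \<and>
    pairwise (\<lambda>P Q. set P \<inter> set Q = {}) Ps \<and>
    (\<forall>P\<in>Ps. set P \<subseteq> {e \<in> E. tail D e \<noteq> tail D' e})"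
  using assms(4,5)
proof (induction j arbitrary: D')
  case 0
  thus ?case by (intro exI[of _ "{}"]) auto
next
  case (Suc j)
  note D = assms(1) and D' = Suc.prems(1)
  interpret fin_digraph D by (rule fin_digraph_orientation[OF D])
  let ?R = "{e \<in> E. tail D e \<noteq> tail D' e}"
  \<comment> \<open>Both orientations give an edge the same two ends, so different tails mean that
    it is reversed.\<close>
  have swap: "tail D' e = head D e \<and> head D' e = tail D e" if "e \<in> ?R" for e
    using that ends_orientation[OF D, of e] ends_orientation[OF D', of e]
    by (auto simp: doubleton_eq_iff)
  have same: "tail D' e = tail D e \<and> head D' e = head D e" if "e \<in> E - ?R" for e
    using that ends_orientation[OF D, of e] ends_orientation[OF D', of e]
    by (auto simp: doubleton_eq_iff)
  obtain P where P: "apath u P x" "set P \<subseteq> ?R"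
  proof (rule apath_or_cut[of u ?R x])
    \<comment> \<open>A closed set \<open>X\<close> would have \<open>Suc j\<close> more leaving
      arcs in \<open>D\<close> than in \<open>D'\<close>, although every arc of \<open>D\<close>
      leaving \<open>X\<close> lies outside \<open>?R\<close> and so leaves \<open>X\<close> in
      \<open>D'\<close> too.\<close>
    fix X assume X: "X \<subseteq> verts D" "u \<in> X" "x \<notin> X"
      "\<And>e. e \<in> ?R \<Longrightarrow> tail D e \<in> X \<Longrightarrow> head D e \<in> X"
    have X': "X \<subseteq> V" using X(1) by (simp add: verts_orientation[OF D])
    hence "finite X" using finite_V finite_subset by blast
    have "int (outdeg_set D X) - int (outdeg_set D' X) =
        (\<Sum>w\<in>X. int (Suc j) * (of_bool (u = w) - of_bool (x = w)))"
      by (simp only: outdeg_set_diff[OF D D' X'] Suc.prems(2))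
    also have "\<dots> = int (Suc j) * (of_bool (u \<in> X) - of_bool (x \<in> X))"
      using \<open>finite X\<close> by (simp only: sum_distrib_left[symmetric]) (simp add: sum_subtractf of_bool_def)
    finally have "outdeg_set D' X < outdeg_set D X" using X(2,3) by simp
    moreover have "outdeg_set D X \<le> outdeg_set D' X"
      unfolding outdeg_set_def arcs_orientation[OF D] arcs_orientation[OF D']
    proof (intro card_mono subsetI)
      fix e assume e: "e \<in> {e \<in> E. tail D e \<in> X \<and> head D e \<notin> X}"
      hence "e \<in> E - ?R" using X(4)[of e] by blast
      from same[OF this] show "e \<in> {e \<in> E. tail D' e \<in> X \<and> head D' e \<notin> X}" using e by simp
    qed (simp add: finite_E)
    ultimately show thesis by simp
  qed (use assms D in \<open>auto simp: verts_orientation arcs_orientation\<close>)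
  let ?D = "reverse_arcs D' P"
  have "P \<noteq> []" using P assms(3) by (auto simp: apath_Nil_iff)
  have PE: "set P \<subseteq> E" using P by auto
  \<comment> \<open>\<open>D'\<close> has the arcs of \<open>P\<close> reversed, so the telescoping
    sum over \<open>P\<close> enters with opposite sign and the flow value drops by one.\<close>
  have deg: "int (outdeg D w) - int (outdeg ?D w) = int j * (of_bool (u = w) - of_bool (x = w))" for w
  proof -
    have "(\<Sum>e\<in>set P. of_bool (head D' e = w) - of_bool (tail D' e = w)) =
        (\<Sum>e\<in>set P. - (of_bool (head D e = w) - of_bool (tail D e = w) :: int))"
    proof (rule sum.cong)
      fix e assume "e \<in> set P"
      from swap[OF subsetD[OF P(2) this]]
      show "of_bool (head D' e = w) - of_bool (tail D' e = w) =
          - (of_bool (head D e = w) - of_bool (tail D e = w) :: int)" by simp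
    qed simp
    also have "\<dots> = of_bool (u = w) - of_bool (x = w)"
      using sum_cas[OF apath_cas[OF D P(1)] distinct_apath[OF D P(1)], of w]
      by (simp only: sum_negf)
    finally show ?thesis
      using Suc.prems(2)[of w] outdeg_reverse_arcs[OF D' PE, of w] by (simp add: algebra_simps)
  qed
  obtain Ps where Ps: "finite Ps" "card Ps = j" "\<forall>Q\<in>Ps. apath u Q x"
      "pairwise (\<lambda>P Q. set P \<inter> set Q = {}) Ps" "\<forall>Q\<in>Ps. set Q \<subseteq> {e \<in> E. tail D e \<noteq> tail ?D e}"
    using Suc.IH[OF orientation_reverse_arcs[OF D'] deg] by auto
  \<comment> \<open>The remaining flow uses no arc of \<open>P\<close>, hence the paths given by the
    induction are disjoint from \<open>P\<close>.\<close>
  have R': "{e \<in> E. tail D e \<noteq> tail ?D e} = ?R - set P"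
  proof -
    have "tail ?D e = tail D e" if "e \<in> set P" for e
      using swap[OF subsetD[OF P(2) that]] that by (simp add: reverse_arcs_def)
    moreover have "tail ?D e = tail D' e" if "e \<notin> set P" for e
      using that by (auto simp: reverse_arcs_def)
    moreover have "tail D' e \<noteq> tail D e" if "e \<in> set P" for e
      using that P(2) by auto
    ultimately show ?thesis by (intro set_eqI) (metis (mono_tags, lifting) DiffD1 DiffD2 DiffI mem_Collect_eq)
  qed
  have "P \<notin> Ps"
  proof
    assume "P \<in> Ps"
    hence "set P \<subseteq> ?R - set P" using Ps(5) unfolding R' by blast
    with \<open>P \<noteq> []\<close> show False by (cases P) auto
  qed
  show ?case
  proof (intro exI[of _ "insert P Ps"] conjI)
    show "pairwise (\<lambda>P Q. set P \<inter> set Q = {}) (insert P Ps)"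
      using Ps(4,5) unfolding R' by (auto simp: pairwise_insert)
  qed (use Ps P \<open>P \<notin> Ps\<close> R' in auto)
qed

text \<open>Ford-Fulkerson: reversing a path lowers every cut separating \<open>u\<close> from
  \<open>x\<close> by exactly one, so \<open>j\<close> augmentations succeed. The augmenting paths
  themselves need not be disjoint; \<open>disjoint_apaths_of_flow\<close> extracts disjoint ones
  from the final digraph.\<close>

lemma flow_of_cuts:
  assumes "orientation_of G D" "u \<in> V"
    and "\<And>X. X \<subseteq> V \<Longrightarrow> u \<in> X \<Longrightarrow> x \<notin> X \<Longrightarrow> j \<le> outdeg_set D X"
  shows "\<exists>D'. orientation_of G D' \<and>
    (\<forall>w. int (outdeg D w) - int (outdeg D' w) = int j * (of_bool (u = w) - of_bool (x = w)))"
  using assms(1,3)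
proof (induction j arbitrary: D)
  case 0
  thus ?case by auto
next
  case (Suc j)
  note D = Suc.prems(1)
  obtain P where P: "pre_digraph.apath D u P x"
    using cut_positive_apath[OF D assms(2)] Suc.prems(2) by (meson Suc_le_lessD less_le_trans zero_less_Suc)
  have "j \<le> outdeg_set (reverse_arcs D P) X" if "X \<subseteq> V" "u \<in> X" "x \<notin> X" for X
    using Suc.prems(2)[OF that] outdeg_set_reverse_apath[OF D P that(1)] that by simp
  from Suc.IH[OF orientation_reverse_arcs[OF D] this] obtain D' where D': "orientation_of G D'"
    "\<And>w. int (outdeg (reverse_arcs D P) w) - int (outdeg D' w) = int j * (of_bool (u = w) - of_bool (x = w))"
    by blast
  show ?case
  proof (intro exI[of _ D'] conjI allI)
    show "int (outdeg D w) - int (outdeg D' w) = int (Suc j) * (of_bool (u = w) - of_bool (x = w))" for w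
      using D'(2)[of w] outdeg_reverse_apath[OF D P, of w] by (simp add: algebra_simps)
  qed (rule D'(1))
qed

text \<open>Menger: disjoint paths cross a cut in distinct arcs; conversely, if all cuts exceed
  \<open>k\<close>, there is a flow of value \<open>Suc k\<close>, which decomposes into disjoint
  paths.\<close>

lemma flippable_iff_cuts:
  assumes D: "orientation_of G D" and "u \<in> V" "x \<in> V" "u \<noteq> x"
  shows "flippable k D u x \<longleftrightarrow> (\<forall>X\<subseteq>V. u \<in> X \<longrightarrow> x \<notin> X \<longrightarrow> k < outdeg_set D X)"
proof -
  interpret fin_digraph D by (rule fin_digraph_orientation[OF D])
  let ?S = "\<lambda>Ps. (\<forall>P\<in>Ps. apath u P x) \<and> pairwise (\<lambda>P Q. set P \<inter> set Q = {}) Ps"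
  have le: "card Ps \<le> outdeg_set D X" if Ps: "?S Ps" and X: "u \<in> X" "x \<notin> X" for Ps X
  proof -
    have "\<exists>e\<in>set P. tail D e \<in> X \<and> head D e \<notin> X" if "P \<in> Ps" for P
      using cas_crosses_cut[OF apath_cas[OF D], of u P x X] that Ps X by auto
    then obtain f where f: "\<And>P. P \<in> Ps \<Longrightarrow> f P \<in> set P \<and> tail D (f P) \<in> X \<and> head D (f P) \<notin> X"
      by metis
    have "inj_on f Ps"
    proof (rule inj_onI, rule ccontr)
      fix P Q assume PQ: "P \<in> Ps" "Q \<in> Ps" "f P = f Q" "P \<noteq> Q"
      hence "set P \<inter> set Q = {}" using Ps by (auto simp: pairwise_def)
      thus False using f[OF PQ(1)] f[OF PQ(2)] PQ(3) by auto
    qed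
    moreover have "f ` Ps \<subseteq> {e \<in> arcs D. tail D e \<in> X \<and> head D e \<notin> X}"
    proof (rule image_subsetI)
      fix P assume "P \<in> Ps"
      thus "f P \<in> {e \<in> arcs D. tail D e \<in> X \<and> head D e \<notin> X}"
        using f[of P] Ps apath_subset_edges[OF D, of u P x] by (auto simp: arcs_orientation[OF D])
    qed
    ultimately show ?thesis
      unfolding outdeg_set_def by (rule card_inj_on_le) simp
  qed
  \<comment> \<open>\<open>Max\<close> is meaningful on a finite non-empty set: the cut
    \<open>{u}\<close> bounds all families, and the empty family is one.\<close>
  have "finite {card Ps |Ps. ?S Ps}"
  proof (rule finite_subset)
    show "{card Ps |Ps. ?S Ps} \<subseteq> {..outdeg_set D {u}}"
    proof
      fix c assume "c \<in> {card Ps |Ps. ?S Ps}"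
      then obtain Ps where "c = card Ps" "?S Ps" by auto
      thus "c \<in> {..outdeg_set D {u}}" using le[of Ps "{u}"] assms by auto
    qed
  qed simp
  moreover have "{card Ps |Ps. ?S Ps} \<noteq> {}"
    by (auto intro!: exI[of _ "{}"])
  ultimately have "flippable k D u x \<longleftrightarrow> (\<exists>Ps. ?S Ps \<and> k < card Ps)"
    using assms unfolding flippable_def max_arc_disjoint_paths_def
    by (subst Max_gr_iff) (auto simp: verts_orientation)
  also have "\<dots> \<longleftrightarrow> (\<forall>X\<subseteq>V. u \<in> X \<longrightarrow> x \<notin> X \<longrightarrow> k < outdeg_set D X)"
  proof
    assume R: "\<forall>X\<subseteq>V. u \<in> X \<longrightarrow> x \<notin> X \<longrightarrow> k < outdeg_set D X"
    obtain D' where "orientation_of G D'"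
      "\<And>w. int (outdeg D w) - int (outdeg D' w) = int (Suc k) * (of_bool (u = w) - of_bool (x = w))"
      using flow_of_cuts[OF D assms(2), of x "Suc k"] R by (auto simp: Suc_le_eq)
    from disjoint_apaths_of_flow[OF D assms(2,4) this]
    obtain Ps where "card Ps = Suc k" "?S Ps" by auto
    thus "\<exists>Ps. ?S Ps \<and> k < card Ps" by (intro exI[of _ Ps]) simp
  next
    assume "\<exists>Ps. ?S Ps \<and> k < card Ps"
    then obtain Ps where "?S Ps" "k < card Ps" by blast
    show "\<forall>X\<subseteq>V. u \<in> X \<longrightarrow> x \<notin> X \<longrightarrow> k < outdeg_set D X"
    proof (intro allI impI)
      fix X assume "u \<in> X" "x \<notin> X"
      from le[OF \<open>?S Ps\<close> this] show "k < outdeg_set D X" using \<open>k < card Ps\<close> by simp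
    qed
  qed
  finally show ?thesis .
qed

end

section \<open>Exchange property of outdegree sequences\<close>

text \<open>The inclusion-maximal members of \<open>T\<close> are pairwise disjoint.\<close>

lemma sum_less_of_intersecting_cover:
  fixes a b :: "'a \<Rightarrow> nat"
  assumes "finite V" "v \<in> V" "a v < b v"
    and sub: "\<And>X. X \<in> T \<Longrightarrow> X \<subseteq> V - {v}"
    and union: "\<And>X Y. X \<in> T \<Longrightarrow> Y \<in> T \<Longrightarrow> X \<inter> Y \<noteq> {} \<Longrightarrow> X \<union> Y \<in> T"
    and le: "\<And>X. X \<in> T \<Longrightarrow> sum a X \<le> sum b X"
    and cover: "\<And>u. u \<in> V \<Longrightarrow> u \<noteq> v \<Longrightarrow> a u = b u \<or> u \<in> \<Union>T"
  shows "sum a V < sum b V"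
proof -
  define M where "M = {X \<in> T. \<forall>Y\<in>T. X \<subseteq> Y \<longrightarrow> X = Y}"
  have "finite T"
    by (rule finite_subset[of _ "Pow V"]) (use sub \<open>finite V\<close> in auto)
  have "\<Union>M = \<Union>T"
  proof
    show "\<Union>T \<subseteq> \<Union>M"
    proof
      fix u assume "u \<in> \<Union>T"
      then obtain X where "X \<in> T" "u \<in> X" by auto
      with finite_has_maximal2[OF \<open>finite T\<close> \<open>X \<in> T\<close>] show "u \<in> \<Union>M"
        unfolding M_def by blast
    qed
  qed (auto simp: M_def)
  have M: "finite X" "sum a X \<le> sum b X" if "X \<in> M" for X
    using that sub[of X] le[of X] \<open>finite V\<close> by (auto simp: M_def dest: finite_subset)
  have disj: "X \<inter> Y = {}" if "X \<in> M" "Y \<in> M" "X \<noteq> Y" for X Y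
  proof (rule ccontr)
    assume "X \<inter> Y \<noteq> {}"
    hence "X \<union> Y \<in> T" using that by (intro union) (auto simp: M_def)
    moreover have "\<forall>Z\<in>T. X \<subseteq> Z \<longrightarrow> X = Z" "\<forall>Z\<in>T. Y \<subseteq> Z \<longrightarrow> Y = Z"
      using that(1,2) by (simp_all add: M_def)
    ultimately show False using that(3) by (metis Un_upper1 Un_upper2)
  qed
  have sum_M: "sum f (\<Union>M) = (\<Sum>X\<in>M. sum f X)" for f :: "'a \<Rightarrow> nat"
  proof -
    have "sum f (\<Union>M) = (sum \<circ> sum) f M"
      by (rule sum.Union_disjoint) (intro ballI impI M(1) disj; assumption)+
    thus ?thesis by simp
  qed
  have "sum a (\<Union>M) \<le> sum b (\<Union>M)"
    unfolding sum_M by (intro sum_mono M(2))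
  \<comment> \<open>No member of \<open>T\<close> contains \<open>v\<close>, so the strict
    inequality at \<open>v\<close> survives here; at all other vertices outside the cover
    \<open>a\<close> and \<open>b\<close> agree.\<close>
  moreover have "sum a (V - \<Union>M) < sum b (V - \<Union>M)"
  proof (rule sum_strict_mono_ex1)
    show "\<forall>u\<in>V - \<Union>M. a u \<le> b u"
      using cover \<open>a v < b v\<close> unfolding \<open>\<Union>M = \<Union>T\<close> by (metis DiffD1 DiffD2 less_imp_le order_refl)
    show "\<exists>u\<in>V - \<Union>M. a u < b u"
      using sub assms(2,3) unfolding \<open>\<Union>M = \<Union>T\<close> by (intro bexI[of _ v]) auto
  qed (use \<open>finite V\<close> in simp)
  moreover have "\<Union>M \<subseteq> V" using sub unfolding \<open>\<Union>M = \<Union>T\<close> by blast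
  ultimately show ?thesis
    using sum.subset_diff[OF _ \<open>finite V\<close>, of "\<Union>M" a] sum.subset_diff[OF _ \<open>finite V\<close>, of "\<Union>M" b]
    by linarith
qed

text \<open>Arc by arc: an arc leaving the intersection or the union leaves \<open>X\<close> or
  \<open>Y\<close>, and an arc leaving both of them leaves both \<open>X\<close> and
  \<open>Y\<close>.\<close>

lemma outdeg_set_submodular:
  assumes "finite (arcs D)"
  shows "outdeg_set D (X \<inter> Y) + outdeg_set D (X \<union> Y) \<le> outdeg_set D X + outdeg_set D Y"
proof -
  have "outdeg_set D Z = (\<Sum>e\<in>arcs D. of_bool (tail D e \<in> Z \<and> head D e \<notin> Z))" for Z
    using assms by (simp add: outdeg_set_def Int_def)
  thus ?thesis
    by (simp only: sum.distrib[symmetric]) (intro sum_mono, auto)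
qed

context loopless_graph
begin

lemma k_connectedD:
  assumes "orientation_of G D" "k_connected k D" "X \<subseteq> V" "X \<noteq> {}" "X \<noteq> V"
  shows "k \<le> outdeg_set D X"
  using assms by (auto simp: k_connected_def verts_orientation)

text \<open>Uncrossing: connectivity bounds both values below by \<open>k\<close>, submodularity
  bounds their sum above by \<open>k + k\<close>.\<close>

lemma tight_Int_Un:
  assumes D: "orientation_of G D" "k_connected k D"
    and "X \<subseteq> V" "Y \<subseteq> V" "outdeg_set D X = k" "outdeg_set D Y = k" "X \<inter> Y \<noteq> {}" "X \<union> Y \<noteq> V"
  shows "outdeg_set D (X \<inter> Y) = k" "outdeg_set D (X \<union> Y) = k"
proof -
  have "k \<le> outdeg_set D (X \<inter> Y)" "k \<le> outdeg_set D (X \<union> Y)"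
    by (intro k_connectedD D; use assms in blast)+
  moreover have "outdeg_set D (X \<inter> Y) + outdeg_set D (X \<union> Y) \<le> k + k"
    using outdeg_set_submodular[of D X Y] assms finite_E by (simp add: arcs_orientation)
  ultimately show "outdeg_set D (X \<inter> Y) = k" "outdeg_set D (X \<union> Y) = k" by auto
qed

text \<open>Both sums count the edges inside \<open>X\<close> equally, and \<open>D\<close> has the
  fewest leaving arcs that connectivity permits.\<close>

lemma sum_outdeg_le_of_tight:
  assumes D: "orientation_of G D" "orientation_of G D'" and "k_connected k D'"
    and X: "X \<subseteq> V" "X \<noteq> {}" "X \<noteq> V" "outdeg_set D X = k"
  shows "sum (outdeg D) X \<le> sum (outdeg D') X"
  using sum_outdeg[OF D(1) X(1)] sum_outdeg[OF D(2) X(1)] k_connectedD[OF D(2) assms(3) X(1-3)] X(4)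
  by simp

text \<open>Otherwise tight sets avoiding \<open>v\<close> cover every vertex outside
  \<open>F\<close> other than \<open>v\<close>. \<open>D'\<close> then has at least the outdegree
  sum of \<open>D\<close> on each of them and more at \<open>v\<close>, but the totals are
  equal.\<close>

lemma exchange_plus:
  assumes D: "orientation_of G D" "k_connected k D" and D': "orientation_of G D'" "k_connected k D'"
    and v: "v \<in> V - F" "outdeg D v < outdeg D' v" and F: "\<And>w. w \<in> F \<Longrightarrow> outdeg D w = outdeg D' w"
  shows "\<exists>u\<in>V - F. u \<noteq> v \<and> flippable k D u v"
proof (rule ccontr)
  assume none: "\<not> ?thesis"
  let ?T = "{X. X \<subseteq> V - {v} \<and> X \<noteq> {} \<and> outdeg_set D X = k}"
  have "sum (outdeg D) V < sum (outdeg D') V"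
  proof (rule sum_less_of_intersecting_cover[where T = ?T and v = v])
    fix X Y assume XY: "X \<in> ?T" "Y \<in> ?T" "X \<inter> Y \<noteq> {}"
    hence "X \<union> Y \<noteq> V" using v by blast
    with XY have "outdeg_set D (X \<union> Y) = k" by (intro tight_Int_Un(2)[OF D]) auto
    thus "X \<union> Y \<in> ?T" using XY by auto
  next
    fix X assume "X \<in> ?T"
    thus "sum (outdeg D) X \<le> sum (outdeg D') X"
      using v by (intro sum_outdeg_le_of_tight[OF D(1) D']) auto
  next
    fix u assume u: "u \<in> V" "u \<noteq> v"
    show "outdeg D u = outdeg D' u \<or> u \<in> \<Union>?T"
    proof (cases "u \<in> F")
      case False
      hence "\<not> flippable k D u v" using none u by auto
      then obtain X where X: "X \<subseteq> V" "u \<in> X" "v \<notin> X" "outdeg_set D X \<le> k"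
        using flippable_iff_cuts[OF D(1) u(1) _ u(2), of k] v by (auto simp: not_less)
      hence "X \<noteq> {}" "X \<noteq> V" using v by auto
      \<comment> \<open>A cut that prevents flippability has at most \<open>k\<close> leaving arcs,
        and by connectivity at least \<open>k\<close>.\<close>
      hence "outdeg_set D X = k" using k_connectedD[OF D X(1)] X(4) by simp
      thus ?thesis using X by blast
    qed (use F in auto)
  qed (use finite_V v in auto)
  thus False using sum_outdeg_V D(1) D'(1) by simp
qed

text \<open>Here the blocking tight sets contain \<open>v\<close>, so \<open>?T\<close> collects
  their complements: intersections of tight sets become unions in \<open>?T\<close>.\<close>

lemma exchange_minus:
  assumes D: "orientation_of G D" "k_connected k D" and D': "orientation_of G D'" "k_connected k D'"
    and v: "v \<in> V - F" "outdeg D' v < outdeg D v" and F: "\<And>w. w \<in> F \<Longrightarrow> outdeg D w = outdeg D' w"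
  shows "\<exists>u\<in>V - F. u \<noteq> v \<and> flippable k D v u"
proof (rule ccontr)
  assume none: "\<not> ?thesis"
  let ?T = "{X. X \<subseteq> V - {v} \<and> X \<noteq> {} \<and> outdeg_set D (V - X) = k}"
  have "sum (outdeg D') V < sum (outdeg D) V"
  proof (rule sum_less_of_intersecting_cover[where T = ?T and v = v])
    fix X Y assume XY: "X \<in> ?T" "Y \<in> ?T" "X \<inter> Y \<noteq> {}"
    have "v \<in> (V - X) \<inter> (V - Y)" using XY v by blast
    moreover have "(V - X) \<union> (V - Y) \<noteq> V" using XY by blast
    ultimately have "outdeg_set D ((V - X) \<inter> (V - Y)) = k"
      using XY by (intro tight_Int_Un(1)[OF D]) auto
    moreover have "(V - X) \<inter> (V - Y) = V - (X \<union> Y)" by blast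
    ultimately show "X \<union> Y \<in> ?T" using XY by auto
  next
    fix X assume X: "X \<in> ?T"
    have le: "sum (outdeg D) (V - X) \<le> sum (outdeg D') (V - X)"
      using X v by (intro sum_outdeg_le_of_tight[OF D(1) D']) auto
    \<comment> \<open>As the totals agree, the inequality on the tight set turns round on its
      complement.\<close>
    have "sum f V = sum f (V - X) + sum f X" for f :: "'v \<Rightarrow> nat"
      using X finite_V by (intro sum.subset_diff) auto
    from this[of "outdeg D"] this[of "outdeg D'"] le show "sum (outdeg D') X \<le> sum (outdeg D) X"
      using sum_outdeg_V[OF D(1)] sum_outdeg_V[OF D'(1)] by linarith
  next
    fix u assume u: "u \<in> V" "u \<noteq> v"
    show "outdeg D' u = outdeg D u \<or> u \<in> \<Union>?T"
    proof (cases "u \<in> F")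
      case False
      hence "\<not> flippable k D v u" using none u by auto
      then obtain X where X: "X \<subseteq> V" "v \<in> X" "u \<notin> X" "outdeg_set D X \<le> k"
        using flippable_iff_cuts[OF D(1) _ u(1), of v k] v u by (auto simp: not_less)
      hence "X \<noteq> {}" "X \<noteq> V" using u by auto
      hence "outdeg_set D X = k" using k_connectedD[OF D X(1)] X(4) by simp
      moreover have "V - (V - X) = X" using X by auto
      ultimately have "V - X \<in> ?T" using X u by auto
      thus ?thesis using X u by blast
    qed (use F in auto)
  qed (use finite_V v in auto)
  thus False using sum_outdeg_V D(1) D'(1) by simp
qed

end

section \<open>Correctness of the enumeration\<close>

lemma outputs_append: "outputs (xs @ ys) = outputs xs @ outputs ys"
  by (induction xs rule: outputs.induct) auto

locale search_procedures = loopless_graph G for G :: "('v, 'e) multigraph" +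
  fixes k :: nat and vs :: "'v list" and find_minus find_plus :: "('v, 'e) search"
  assumes set_vs: "set vs = V"
    and find_minus: "valid_search_minus G k find_minus"
    and find_plus: "valid_search_plus G k find_plus"
begin

text \<open>Invariant of all calls; \<open>F\<close> holds the vertices whose outdegrees are
  frozen.\<close>

definition state :: "('v, 'e) pre_digraph \<Rightarrow> 'v set \<Rightarrow> bool" where
  "state D F \<longleftrightarrow> orientation_of G D \<and> k_connected k D \<and> F \<subseteq> V"

lemma state_insert: "state D F \<Longrightarrow> v \<in> V \<Longrightarrow> state D (insert v F)"
  by (simp add: state_def)

text \<open>The sequences that a call with frozen set \<open>F\<close> has to list. Only the values
  of \<alpha> on \<open>F\<close> matter, so reversals that keep these do not change the
  set.\<close>

definition extensions :: "('v \<Rightarrow> nat) \<Rightarrow> 'v set \<Rightarrow> ('v \<Rightarrow> nat) set" where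
  "extensions \<alpha> F = {\<beta>. k_connected_outdeg_seq G k \<beta> \<and> (\<forall>w\<in>F. \<beta> w = \<alpha> w)}"

lemma extensions_cong: "(\<And>w. w \<in> F \<Longrightarrow> \<alpha> w = \<alpha>' w) \<Longrightarrow> extensions \<alpha> F = extensions \<alpha>' F"
  by (auto simp: extensions_def)

lemma extensions_insert: "extensions \<alpha> (insert v F) = {\<beta> \<in> extensions \<alpha> F. \<beta> v = \<alpha> v}"
  by (auto simp: extensions_def)

lemma extensions_V:
  assumes "state D V"
  shows "extensions (outdeg D) V = {outdeg D}"
proof -
  have "\<beta> = outdeg D" if \<beta>: "\<beta> \<in> extensions (outdeg D) V" for \<beta>
  proof -
    obtain D' where D': "orientation_of G D'" "\<beta> = outdeg D'"
      using \<beta> by (auto simp: extensions_def k_connected_outdeg_seq_def)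
    have "outdeg D' w = outdeg D w" for w
      using \<beta> D' assms outdeg_outside
      by (cases "w \<in> V") (auto simp: extensions_def state_def)
    thus ?thesis using D' by auto
  qed
  moreover have "outdeg D \<in> extensions (outdeg D) V"
    using assms by (auto simp: state_def extensions_def k_connected_outdeg_seq_def)
  ultimately show ?thesis by blast
qed

lemma smallest_outside_in: "F \<subseteq> V \<Longrightarrow> F \<noteq> V \<Longrightarrow> smallest_outside vs F \<in> V - F"
proof -
  assume "F \<subseteq> V" "F \<noteq> V"
  hence "filter (\<lambda>v. v \<notin> F) vs \<noteq> []" using set_vs by (auto simp: filter_empty_conv)
  from hd_in_set[OF this] show ?thesis using set_vs by (simp add: smallest_outside_def)
qed

text \<open>Flippability gives an excess in just those cuts that lose a unit, and both ends of the
  path lie outside \<open>F\<close>. \<open>Suc\<close> on the left avoids subtraction of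
  naturals.\<close>

lemma reverse_apath_step:
  assumes "state D F" "u \<in> V - F" "x \<in> V - F" "flippable k D u x" "pre_digraph.apath D u P x"
  shows "state (reverse_arcs D P) F"
    and "\<And>w. w \<in> F \<Longrightarrow> outdeg (reverse_arcs D P) w = outdeg D w"
    and "Suc (outdeg (reverse_arcs D P) u) = outdeg D u"
    and "outdeg (reverse_arcs D P) x = Suc (outdeg D x)"
proof -
  have D: "orientation_of G D" and ne: "u \<noteq> x"
    using assms by (auto simp: state_def flippable_def)
  have "\<forall>X\<subseteq>V. u \<in> X \<longrightarrow> x \<notin> X \<longrightarrow> k < outdeg_set D X"
    using flippable_iff_cuts[OF D _ _ ne] assms by blast
  thus "state (reverse_arcs D P) F"
    using assms k_connected_reverse_apath[OF D assms(5)] orientation_reverse_arcs[OF D]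
    by (auto simp: state_def)
  show "outdeg (reverse_arcs D P) w = outdeg D w" if "w \<in> F" for w
    using outdeg_reverse_apath[OF D assms(5), of w] that assms(2,3)
    by (cases "x = w"; cases "u = w") auto
  show "Suc (outdeg (reverse_arcs D P) u) = outdeg D u"
    and "outdeg (reverse_arcs D P) x = Suc (outdeg D x)"
    using outdeg_reverse_apath[OF D assms(5), of u] outdeg_reverse_apath[OF D assms(5), of x] ne
    by auto
qed

lemma minus_step:
  assumes "state D F" "v \<in> V - F" "find_minus D F v = (Some (u, P), t)"
  shows "state (reverse_arcs D P) F"
    and "\<And>w. w \<in> F \<Longrightarrow> outdeg (reverse_arcs D P) w = outdeg D w"
    and "Suc (outdeg (reverse_arcs D P) v) = outdeg D v"
    and "pre_digraph.apath D v P u"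
proof -
  have *: "u \<in> V - F" "flippable k D v u" "pre_digraph.apath D v P u"
    using find_minus[unfolded valid_search_minus_def, rule_format, of D F v] assms
    by (auto simp: state_def)
  show "state (reverse_arcs D P) F"
    and "\<And>w. w \<in> F \<Longrightarrow> outdeg (reverse_arcs D P) w = outdeg D w"
    and "Suc (outdeg (reverse_arcs D P) v) = outdeg D v"
    using reverse_apath_step(1-3)[OF assms(1,2) *] by auto
qed (use find_minus[unfolded valid_search_minus_def, rule_format, of D F v] assms
  in \<open>auto simp: state_def\<close>)

lemma plus_step:
  assumes "state D F" "v \<in> V - F" "find_plus D F v = (Some (u, P), t)"
  shows "state (reverse_arcs D P) F"
    and "\<And>w. w \<in> F \<Longrightarrow> outdeg (reverse_arcs D P) w = outdeg D w"
    and "outdeg (reverse_arcs D P) v = Suc (outdeg D v)"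
    and "pre_digraph.apath D u P v"
proof -
  have *: "u \<in> V - F" "flippable k D u v" "pre_digraph.apath D u P v"
    using find_plus[unfolded valid_search_plus_def, rule_format, of D F v] assms
    by (auto simp: state_def)
  show "state (reverse_arcs D P) F"
    and "\<And>w. w \<in> F \<Longrightarrow> outdeg (reverse_arcs D P) w = outdeg D w"
    and "outdeg (reverse_arcs D P) v = Suc (outdeg D v)"
    using reverse_apath_step(1,2,4)[OF assms(1) *(1) assms(2) *(2,3)] by auto
qed (use find_plus[unfolded valid_search_plus_def, rule_format, of D F v] assms
  in \<open>auto simp: state_def\<close>)

text \<open>By the exchange property, a failed search certifies that no sequence with a smaller
  value at \<open>v\<close> has been missed.\<close>

lemma minus_None:
  assumes "state D F" "v \<in> V - F" "find_minus D F v = (None, t)"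
  shows "{\<beta> \<in> extensions (outdeg D) F. \<beta> v < outdeg D v} = {}"
proof -
  have "\<not> (\<exists>u\<in>V - F. u \<noteq> v \<and> flippable k D v u)"
    using find_minus[unfolded valid_search_minus_def, rule_format, of D F v] assms
    by (auto simp: state_def)
  hence "\<not> outdeg D' v < outdeg D v" if "orientation_of G D'" "k_connected k D'"
      "\<And>w. w \<in> F \<Longrightarrow> outdeg D w = outdeg D' w" for D'
    using exchange_minus[of D k D' v F] that assms(1,2) by (auto simp: state_def)
  thus ?thesis by (fastforce simp: extensions_def k_connected_outdeg_seq_def)
qed

lemma plus_None:
  assumes "state D F" "v \<in> V - F" "find_plus D F v = (None, t)"
  shows "{\<beta> \<in> extensions (outdeg D) F. \<beta> v > outdeg D v} = {}"
proof -
  have "\<not> (\<exists>u\<in>V - F. u \<noteq> v \<and> flippable k D u v)"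
    using find_plus[unfolded valid_search_plus_def, rule_format, of D F v] assms
    by (auto simp: state_def)
  hence "\<not> outdeg D v < outdeg D' v" if "orientation_of G D'" "k_connected k D'"
      "\<And>w. w \<in> F \<Longrightarrow> outdeg D w = outdeg D' w" for D'
    using exchange_plus[of D k D' v F] that assms(1,2) by (auto simp: state_def)
  thus ?thesis by (fastforce simp: extensions_def k_connected_outdeg_seq_def)
qed

text \<open>After a step of the minus procedure, a sequence below the old value at \<open>v\<close>
  either has the new value there (\<open>en_ods\<close> with \<open>v\<close> frozen) or a smaller
  one (nested call); dually for plus. \<open>en_ods\<close> splits by smaller, larger or equal value
  at \<open>v\<close>. The cases exclude each other, so nothing is output twice.\<close>

lemma outputs_correct:
  shows "reverse_minus vs find_minus find_plus D F v tr \<Longrightarrow> state D F \<Longrightarrow> v \<in> V - F \<Longrightarrow>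
      distinct (outputs tr) \<and> set (outputs tr) = {\<beta> \<in> extensions (outdeg D) F. \<beta> v < outdeg D v}"
    and "reverse_plus vs find_minus find_plus D F v tr \<Longrightarrow> state D F \<Longrightarrow> v \<in> V - F \<Longrightarrow>
      distinct (outputs tr) \<and> set (outputs tr) = {\<beta> \<in> extensions (outdeg D) F. \<beta> v > outdeg D v}"
    and "en_ods vs find_minus find_plus D F tr \<Longrightarrow> state D F \<Longrightarrow>
      distinct (outputs tr) \<and> set (outputs tr) = extensions (outdeg D) F"
proof (induction rule: reverse_minus_reverse_plus_en_ods.inducts)
  case (minus_none D F v t)
  show ?case using minus_None[OF minus_none(2,3,1)] by simp
next
  case (minus_some D F v u P t D' t' tr1 tr2)
  have D': "D' = reverse_arcs D P" using minus_some.hyps by (simp add: reverse_path_def)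
  note step = minus_step[OF minus_some.prems \<open>find_minus D F v = _\<close>, folded D']
  have "extensions (outdeg D') F = extensions (outdeg D) F"
    using step(2) by (rule extensions_cong)
  moreover have "state D' (insert v F)" using step(1) minus_some.prems by (auto simp: state_insert)
  ultimately show ?case
    using minus_some.IH step(1) step(3)[symmetric] minus_some.prems
    by (auto simp: outputs_append extensions_insert)
next
  case (plus_none D F v t)
  show ?case using plus_None[OF plus_none(2,3,1)] by simp
next
  case (plus_some D F v u P t D' t' tr1 tr2)
  have D': "D' = reverse_arcs D P" using plus_some.hyps by (simp add: reverse_path_def)
  note step = plus_step[OF plus_some.prems \<open>find_plus D F v = _\<close>, folded D']
  have "extensions (outdeg D') F = extensions (outdeg D) F"
    using step(2) by (rule extensions_cong)
  moreover have "state D' (insert v F)" using step(1) plus_some.prems by (auto simp: state_insert)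
  ultimately show ?case
    using plus_some.IH step(1) step(3) plus_some.prems
    by (auto simp: outputs_append extensions_insert)
next
  case (en_ods_recurse F D v tr1 tr2 tr3)
  have "v \<in> V - F"
    using en_ods_recurse smallest_outside_in by (auto simp: state_def verts_orientation)
  with en_ods_recurse show ?case
    by (auto simp: outputs_append extensions_insert state_insert)
next
  case (en_ods_output F D)
  hence "F = V" by (auto simp: state_def verts_orientation)
  with en_ods_output extensions_V show ?case by auto
qed

section \<open>Termination of the recursion\<close>

lemma ex_reverse_minus:
  assumes "\<And>D. state D (insert v F) \<Longrightarrow> \<exists>tr. en_ods vs find_minus find_plus D (insert v F) tr"
    and "state D F" "v \<in> V - F"
  shows "\<exists>tr. reverse_minus vs find_minus find_plus D F v tr"
  using assms(2)
proof (induction "outdeg D v" arbitrary: D rule: less_induct)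
  case less
  show ?case
  proof (cases "find_minus D F v")
    case (Pair r t)
    show ?thesis
    proof (cases r)
      case None
      thus ?thesis using Pair minus_none[of find_minus D F v t] by blast
    next
      case (Some up)
      obtain u P where up: "up = (u, P)" by (cases up)
      note step = minus_step[OF less.prems assms(3) Pair[unfolded Some up]]
      have "outdeg (reverse_arcs D P) v < outdeg D v" using step(3) by simp
      from less.hyps[OF this step(1)] obtain tr1
        where tr1: "reverse_minus vs find_minus find_plus (reverse_arcs D P) F v tr1" by blast
      obtain tr2 where tr2: "en_ods vs find_minus find_plus (reverse_arcs D P) (insert v F) tr2"
        using assms(1,3) state_insert[OF step(1)] by blast
      show ?thesis
        using minus_some[OF Pair[unfolded Some up] reverse_path_def tr1 tr2] by blast
    qed
  qed
qed

lemma ex_reverse_plus: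
  assumes "\<And>D. state D (insert v F) \<Longrightarrow> \<exists>tr. en_ods vs find_minus find_plus D (insert v F) tr"
    and "state D F" "v \<in> V - F"
  shows "\<exists>tr. reverse_plus vs find_minus find_plus D F v tr"
  using assms(2)
proof (induction "card E - outdeg D v" arbitrary: D rule: less_induct)
  case less
  show ?case
  proof (cases "find_plus D F v")
    case (Pair r t)
    show ?thesis
    proof (cases r)
      case None
      thus ?thesis using Pair plus_none[of find_plus D F v t] by blast
    next
      case (Some up)
      obtain u P where up: "up = (u, P)" by (cases up)
      note step = plus_step[OF less.prems assms(3) Pair[unfolded Some up]]
      \<comment> \<open>This bound makes the truncated difference in the measure strictly
        decrease.\<close>
      have "outdeg (reverse_arcs D P) v \<le> card E"
        using step(1) outdeg_set_le_card by (simp add: state_def outdeg_def)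
      hence "card E - outdeg (reverse_arcs D P) v < card E - outdeg D v" using step(3) by simp
      from less.hyps[OF this step(1)] obtain tr1
        where tr1: "reverse_plus vs find_minus find_plus (reverse_arcs D P) F v tr1" by blast
      obtain tr2 where tr2: "en_ods vs find_minus find_plus (reverse_arcs D P) (insert v F) tr2"
        using assms(1,3) state_insert[OF step(1)] by blast
      show ?thesis
        using plus_some[OF Pair[unfolded Some up] reverse_path_def tr1 tr2] by blast
    qed
  qed
qed

text \<open>Lexicographic termination: each inner \<open>en_ods\<close> call freezes one more
  vertex, and for fixed \<open>F\<close> the nested calls of one procedure move
  \<open>outdeg D v\<close> monotonically between 0 and \<open>card E\<close>.\<close>

lemma ex_en_ods:
  assumes "state D F"
  shows "\<exists>tr. en_ods vs find_minus find_plus D F tr"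
  using assms
proof (induction "card (V - F)" arbitrary: D F rule: less_induct)
  case less
  have verts: "verts D = V" using less.prems by (simp add: state_def verts_orientation)
  show ?case
  proof (cases "F = V")
    case True
    thus ?thesis using en_ods_output[of F D] verts by blast
  next
    case False
    define v where "v = smallest_outside vs F"
    have v: "v \<in> V - F" using smallest_outside_in False less.prems by (auto simp: v_def state_def)
    have "card (V - insert v F) < card (V - F)"
      using v finite_V by (intro psubset_card_mono) auto
    from less.hyps[OF this]
    have IH: "\<exists>tr. en_ods vs find_minus find_plus D' (insert v F) tr" if "state D' (insert v F)" for D'
      using that by blast
    obtain tr1 tr2 tr3 where "reverse_minus vs find_minus find_plus D F v tr1"
      "reverse_plus vs find_minus find_plus D F v tr2"
      "en_ods vs find_minus find_plus D (insert v F) tr3"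
      using ex_reverse_minus[OF IH less.prems v] ex_reverse_plus[OF IH less.prems v]
        IH[OF state_insert[OF less.prems]] v by blast
    from en_ods_recurse[OF _ v_def this] show ?thesis using False verts by blast
  qed
qed

lemma algorithm3_correct:
  assumes "valid_initial G k init"
  shows "\<exists>tr. algorithm3 vs find_minus find_plus init tr"
    and "algorithm3 vs find_minus find_plus init tr \<Longrightarrow>
      distinct (outputs tr) \<and> set (outputs tr) = {\<alpha>. k_connected_outdeg_seq G k \<alpha>}"
proof -
  have init: "state D {}" if "fst init = Some D" for D
    using assms that by (auto simp: valid_initial_def state_def)
  show "\<exists>tr. algorithm3 vs find_minus find_plus init tr"
  proof (cases init)
    case (Pair r t)
    show ?thesis
    proof (cases r)
      case None
      thus ?thesis using Pair no_orientation by blast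
    next
      case (Some D)
      thus ?thesis using Pair ex_en_ods[OF init[of D]] orientation by fastforce
    qed
  qed
  show "distinct (outputs tr) \<and> set (outputs tr) = {\<alpha>. k_connected_outdeg_seq G k \<alpha>}"
    if "algorithm3 vs find_minus find_plus init tr"
    using that
  proof cases
    case (no_orientation t)
    thus ?thesis using assms by (auto simp: valid_initial_def k_connected_outdeg_seq_def)
  next
    case (orientation D tr' t)
    thus ?thesis using outputs_correct(3)[OF _ init, of D tr'] by (simp add: extensions_def)
  qed
qed

end

section \<open>Gaps between outputs\<close>

lemma gaps_nonempty: "gaps g tr \<noteq> []"
  by (induction g tr rule: gaps.induct) auto

text \<open>The last gap of \<open>xs\<close> is still open and continues into
  \<open>ys\<close>.\<close>

lemma gaps_append: "gaps g (xs @ ys) = butlast (gaps g xs) @ gaps (last (gaps g xs)) ys"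
  by (induction g xs rule: gaps.induct) (auto simp: gaps_nonempty)

text \<open>\<open>L\<close> bounds the last gap separately from \<open>M\<close>, because it is the
  work handed over to whatever runs next.\<close>

definition gaps_within :: "nat \<Rightarrow> 'a event list \<Rightarrow> nat \<Rightarrow> nat \<Rightarrow> bool" where
  "gaps_within g tr M L \<longleftrightarrow> (\<forall>x\<in>set (gaps g tr). x \<le> M) \<and> last (gaps g tr) \<le> L"

lemma gaps_within_append:
  assumes "gaps_within g xs M L" "\<And>h. h \<le> L \<Longrightarrow> gaps_within h ys M L'"
  shows "gaps_within g (xs @ ys) M L'"
  using assms unfolding gaps_within_def gaps_append
  by (auto simp: gaps_nonempty dest: in_set_butlastD)

lemma gaps_within_Work: "gaps_within (g + t) tr M L \<Longrightarrow> gaps_within g (Work t # tr) M L"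
  by (simp add: gaps_within_def)

lemma gaps_within_mono: "gaps_within g tr M L \<Longrightarrow> L \<le> L' \<Longrightarrow> gaps_within g tr M L'"
  by (auto simp: gaps_within_def)

lemma delay_le: "gaps_within 0 tr M L \<Longrightarrow> delay tr \<le> M"
  by (auto simp: gaps_within_def delay_def gaps_nonempty)

section \<open>Delay of the recursion\<close>

lemma (in loopless_graph) sum_degrees: "(\<Sum>v\<in>V. card {e \<in> E. v \<in> ends G e}) = 2 * card E"
proof -
  have "(\<Sum>v\<in>V. card {e \<in> E. v \<in> ends G e}) = (\<Sum>v\<in>V. \<Sum>e\<in>E. of_bool (v \<in> ends G e))"
    by (simp add: finite_E Int_def)
  also have "\<dots> = (\<Sum>e\<in>E. \<Sum>v\<in>V. of_bool (v \<in> ends G e))" by (rule sum.swap)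
  also have "\<dots> = (\<Sum>e\<in>E. card (ends G e))"
    using ends_subset finite_V by (intro sum.cong) (auto simp: Int_absorb1)
  finally show ?thesis using card_ends by simp
qed

text \<open>\<open>S\<close> pays for one Reverse call without its subcalls: its own step, the
  search, copying \<open>card E\<close> arcs and swapping at most \<open>card V\<close> of
  them.\<close>

locale timed_search_procedures = search_procedures G k vs find_minus find_plus
  for G :: "('v, 'e) multigraph" and k vs find_minus find_plus +
  fixes S :: nat
  assumes length_vs: "length vs = card V"
    and time_minus: "orientation_of G D \<Longrightarrow> v \<in> V \<Longrightarrow>
      1 + snd (find_minus D F v) + card E + card V \<le> S"
    and time_plus: "orientation_of G D \<Longrightarrow> v \<in> V \<Longrightarrow>
      1 + snd (find_plus D F v) + card E + card V \<le> S"
begin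

abbreviation "degree v \<equiv> card {e \<in> E. v \<in> ends G e}"

text \<open>Per vertex, \<open>degree v + 1\<close> searches belong to one chain of nested calls and
  2 more to work left open before; \<open>2 * card V + 1\<close> pays for the call, the choice of
  \<open>v\<close> and forming \<open>insert v F\<close>. The last bracket is the final call and the
  writing of the output.\<close>

definition gap_bound :: "'v set \<Rightarrow> nat" where
  "gap_bound F = (\<Sum>v\<in>V - F. (degree v + 3) * S + 2 * card V + 1) + (1 + 2 * card V + card E)"

lemma gap_bound_insert:
  assumes "v \<in> V - F"
  shows "gap_bound F = gap_bound (insert v F) + (degree v + 3) * S + 2 * card V + 1"
proof -
  have eq: "V - F = insert v (V - insert v F)" using assms by auto
  have "(\<Sum>v\<in>V - F. (degree v + 3) * S + 2 * card V + 1) =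
      ((degree v + 3) * S + 2 * card V + 1) +
      (\<Sum>v\<in>V - insert v F. (degree v + 3) * S + 2 * card V + 1)"
    using finite_V by (subst eq, subst sum.insert) auto
  thus ?thesis by (simp add: gap_bound_def)
qed

lemma outdeg_le_degree:
  assumes "state D F"
  shows "outdeg D v \<le> degree v"
proof -
  have D: "orientation_of G D" using assms by (simp add: state_def)
  show ?thesis unfolding outdeg_eq_card[OF D]
    using ends_orientation[OF D] by (intro card_mono) (auto simp: finite_E)
qed

lemma reverse_path_time:
  assumes "state D F" "pre_digraph.apath D u P x"
  shows "snd (reverse_path D P) \<le> card E + card V"
proof -
  have D: "orientation_of G D" using assms by (simp add: state_def)
  interpret fin_digraph D by (rule fin_digraph_orientation[OF D])
  show ?thesis
    using length_apath[OF assms(2)] D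
    by (simp add: reverse_path_def verts_orientation arcs_orientation)
qed

text \<open>A nested call of \<open>Reverse\<^sup>-\<close> lowers the outdegree of \<open>v\<close>, so these calls are nested at most
  \<open>outdeg D v\<close> times; similarly for \<open>Reverse\<^sup>+\<close>.\<close>

lemma gaps_bounded:
  shows "reverse_minus vs find_minus find_plus D F v tr \<Longrightarrow> state D F \<Longrightarrow> v \<in> V - F \<Longrightarrow>
      (\<forall>g M. g + ((outdeg D v + 1) * S + card V + gap_bound (insert v F)) \<le> M \<longrightarrow>
        gaps_within g tr M (g + S))"
    and "reverse_plus vs find_minus find_plus D F v tr \<Longrightarrow> state D F \<Longrightarrow> v \<in> V - F \<Longrightarrow>
      (\<forall>g M. g + ((degree v - outdeg D v + 1) * S + card V + gap_bound (insert v F)) \<le> M \<longrightarrow>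
        gaps_within g tr M (g + S))"
    and "en_ods vs find_minus find_plus D F tr \<Longrightarrow> state D F \<Longrightarrow>
      (\<forall>g M. g + gap_bound F \<le> M \<longrightarrow> gaps_within g tr M 0)"
proof (induct rule: reverse_minus_reverse_plus_en_ods.inducts)
  case (minus_none D F v t)
  show ?case using time_minus[of D v F] minus_none by (auto simp: gaps_within_def state_def)
next
  case (minus_some D F v u P t D' t' tr1 tr2)
  note prems = minus_some.prems
  have D': "D' = reverse_arcs D P" "t' = snd (reverse_path D P)"
    using minus_some.hyps by (auto simp: reverse_path_def)
  note step = minus_step[OF prems \<open>find_minus D F v = _\<close>, folded D'(1)]
  have c: "1 + t + t' \<le> S"
    using time_minus[of D v F] prems reverse_path_time[OF prems(1) step(4)] \<open>find_minus D F v = _\<close> D'(2)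
    by (simp add: state_def)
  have state: "state D' (insert v F)" using step(1) prems by (auto simp: state_insert)
  show ?case
  proof (intro allI impI)
    fix g M assume M: "g + ((outdeg D v + 1) * S + card V + gap_bound (insert v F)) \<le> M"
    \<comment> \<open>The decrease of the outdegree frees one \<open>S\<close>, which pays for this
      call.\<close>
    have M': "g + ((outdeg D' v + 1) * S + S + card V + gap_bound (insert v F)) \<le> M"
      using M by (simp add: step(3)[symmetric] algebra_simps)
    \<comment> \<open>\<open>en_ods\<close> stops right after an output, so the last gap is 0; the
      bound \<open>g + S\<close> in the claim accommodates a failed search.\<close>
    have "gaps_within g ([Work (1 + t + t')] @ tr1 @ [Work (length vs)] @ tr2) M 0"
      unfolding append_Cons append_Nil
    proof (intro gaps_within_Work gaps_within_append)
      show "gaps_within (g + (1 + t + t')) tr1 M (g + (1 + t + t') + S)"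
        using c M' by (intro minus_some.hyps(4)[rule_format, OF step(1) prems(2)]) simp
      fix h assume "h \<le> g + (1 + t + t') + S"
      hence "h + length vs + gap_bound (insert v F) \<le> M"
        using M' c length_vs by simp
      thus "gaps_within (h + length vs) tr2 M 0"
        by (intro minus_some.hyps(6)[rule_format, OF state])
    qed
    thus "gaps_within g ([Work (1 + t + t')] @ tr1 @ [Work (length vs)] @ tr2) M (g + S)"
      by (rule gaps_within_mono) simp
  qed
next
  case (plus_none D F v t)
  show ?case using time_plus[of D v F] plus_none by (auto simp: gaps_within_def state_def)
next
  case (plus_some D F v u P t D' t' tr1 tr2)
  note prems = plus_some.prems
  have D': "D' = reverse_arcs D P" "t' = snd (reverse_path D P)"
    using plus_some.hyps by (auto simp: reverse_path_def)
  note step = plus_step[OF prems \<open>find_plus D F v = _\<close>, folded D'(1)]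
  have c: "1 + t + t' \<le> S"
    using time_plus[of D v F] prems reverse_path_time[OF prems(1) step(4)] \<open>find_plus D F v = _\<close> D'(2)
    by (simp add: state_def)
  have state: "state D' (insert v F)" using step(1) prems by (auto simp: state_insert)
  have deg: "degree v - outdeg D v = Suc (degree v - outdeg D' v)"
    using outdeg_le_degree[OF step(1), of v] step(3) by simp
  show ?case
  proof (intro allI impI)
    fix g M
    assume M: "g + ((degree v - outdeg D v + 1) * S + card V + gap_bound (insert v F)) \<le> M"
    have M': "g + ((degree v - outdeg D' v + 1) * S + S + card V + gap_bound (insert v F)) \<le> M"
      using M unfolding deg by (simp add: algebra_simps)
    have "gaps_within g ([Work (1 + t + t')] @ tr1 @ [Work (length vs)] @ tr2) M 0"
      unfolding append_Cons append_Nil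
    proof (intro gaps_within_Work gaps_within_append)
      show "gaps_within (g + (1 + t + t')) tr1 M (g + (1 + t + t') + S)"
        using c M' by (intro plus_some.hyps(4)[rule_format, OF step(1) prems(2)]) simp
      fix h assume "h \<le> g + (1 + t + t') + S"
      hence "h + length vs + gap_bound (insert v F) \<le> M"
        using M' c length_vs by simp
      thus "gaps_within (h + length vs) tr2 M 0"
        by (intro plus_some.hyps(6)[rule_format, OF state])
    qed
    thus "gaps_within g ([Work (1 + t + t')] @ tr1 @ [Work (length vs)] @ tr2) M (g + S)"
      by (rule gaps_within_mono) simp
  qed
next
  case (en_ods_recurse F D v tr1 tr2 tr3)
  have v: "v \<in> V - F"
    using en_ods_recurse smallest_outside_in by (auto simp: state_def verts_orientation)
  have state: "state D (insert v F)" using en_ods_recurse.prems v by (auto simp: state_insert)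
  have deg: "(outdeg D v + 1) * S \<le> (degree v + 1) * S"
    "(degree v - outdeg D v + 1) * S \<le> (degree v + 1) * S"
    using outdeg_le_degree[OF en_ods_recurse.prems] by (intro mult_le_mono1; simp)+
  show ?case
  proof (intro allI impI)
    fix g M assume "g + gap_bound F \<le> M"
    hence M: "g + (gap_bound (insert v F) + (degree v + 1) * S + 2 * S + 2 * card V + 1) \<le> M"
      unfolding gap_bound_insert[OF v] by (simp add: algebra_simps)
    show "gaps_within g ([Work (1 + length vs)] @ tr1 @ tr2 @ [Work (length vs)] @ tr3) M 0"
      unfolding append_Cons append_Nil
    proof (intro gaps_within_Work gaps_within_append)
      let ?g = "g + (1 + length vs)"
      show "gaps_within ?g tr1 M (?g + S)"
        using M deg length_vs
          by (intro en_ods_recurse.hyps(4)[rule_format, OF en_ods_recurse.prems v]) linarith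
      fix h assume h: "h \<le> ?g + S"
      have "gaps_within h tr2 M (h + S)"
        using M deg h length_vs
          by (intro en_ods_recurse.hyps(6)[rule_format, OF en_ods_recurse.prems v]) linarith
      \<comment> \<open>Both Reverse calls may end without an output, each leaving at most one
        \<open>S\<close> of open work.\<close>
      thus "gaps_within h tr2 M (?g + 2 * S)"
        by (rule gaps_within_mono) (use h in simp)
      fix h' assume "h' \<le> ?g + 2 * S"
      hence "h' + length vs + gap_bound (insert v F) \<le> M"
        using M length_vs by simp
      thus "gaps_within (h' + length vs) tr3 M 0"
        by (intro en_ods_recurse.hyps(8)[rule_format, OF state])
    qed
  qed
next
  case (en_ods_output F D)
  thus ?case
    by (auto simp: gaps_within_def gap_bound_def length_vs state_def verts_orientation arcs_orientation)
qed

end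

section \<open>Graph search\<close>

locale adjacency_lists = loopless_graph G for G :: "('v, 'e) multigraph" +
  fixes vs :: "'v list" and inc :: "'v \<Rightarrow> 'e list"
  assumes adjacency: "adjacency_rep G vs inc"
begin

lemma set_vs: "set vs = V" and length_vs: "length vs = card V"
  and set_inc: "v \<in> V \<Longrightarrow> set (inc v) = {e \<in> E. v \<in> ends G e}"
  using adjacency distinct_card[of vs] by (auto simp: adjacency_rep_def)

lemma length_inc: "v \<in> V \<Longrightarrow> length (inc v) = card {e \<in> E. v \<in> ends G e}"
  using adjacency distinct_card[of "inc v"] by (simp add: adjacency_rep_def)

lemma sum_length_inc: "(\<Sum>v\<in>V. length (inc v) + 2) = 2 * card E + 2 * card V"
proof -
  have "(\<Sum>v\<in>V. length (inc v) + 2) = (\<Sum>v\<in>V. card {e \<in> E. v \<in> ends G e}) + (\<Sum>v\<in>V. 2)"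
    unfolding sum.distrib[symmetric] by (intro sum.cong) (auto simp: length_inc)
  thus ?thesis by (simp add: sum_degrees)
qed

text \<open>The root \<open>s\<close> has no parent arc and is therefore added separately.\<close>

definition reached :: "'v \<Rightarrow> ('v \<rightharpoonup> 'e) \<Rightarrow> 'v set" where
  "reached s par = insert s (dom par)"

text \<open>The parent arcs spell out the path itself, so following them back from \<open>y\<close>
  recovers it; as no vertex repeats, this takes at most \<open>card V\<close> rounds.\<close>

definition search_tree :: "('v, 'e) pre_digraph \<Rightarrow> 'v \<Rightarrow> ('v \<rightharpoonup> 'e) \<Rightarrow> bool" where
  "search_tree D s par \<longleftrightarrow> (\<forall>y\<in>reached s par. \<exists>P. pre_digraph.apath D s P y \<and>
     (\<forall>e\<in>set P. par (head D e) = Some e))"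

context
  fixes D :: "('v, 'e) pre_digraph" and s :: 'v
  assumes D: "orientation_of G D" and s: "s \<in> V"
begin

lemma reached_subset: "search_tree D s par \<Longrightarrow> reached s par \<subseteq> V"
proof
  interpret fin_digraph D by (rule fin_digraph_orientation[OF D])
  fix y assume "search_tree D s par" "y \<in> reached s par"
  then obtain P where "apath s P y" by (auto simp: search_tree_def)
  hence "y \<in> verts D" using awalk_last_in_verts by (auto simp: apath_def)
  thus "y \<in> V" by (simp add: verts_orientation[OF D])
qed

lemma search_tree_empty: "search_tree D s Map.empty"
proof -
  interpret fin_digraph D by (rule fin_digraph_orientation[OF D])
  show ?thesis using s
    by (auto simp: search_tree_def reached_def apath_Nil_iff verts_orientation[OF D] intro!: exI[of _ "[]"])
qed

lemma search_tree_update: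
  assumes tree: "search_tree D s par" and e: "e \<in> E" "tail D e \<in> reached s par" "head D e \<notin> reached s par"
  shows "search_tree D s (par(head D e \<mapsto> e))"
  unfolding search_tree_def
proof
  interpret fin_digraph D by (rule fin_digraph_orientation[OF D])
  let ?par = "par(head D e \<mapsto> e)"
  fix y assume "y \<in> reached s ?par"
  have old: "?par (head D e') = Some e'" if "par (head D e') = Some e'" for e'
    using that e(3) by (auto simp: reached_def)
  show "\<exists>P. apath s P y \<and> (\<forall>e\<in>set P. ?par (head D e) = Some e)"
  proof (cases "y = head D e")
    case False
    hence "y \<in> reached s par" using \<open>y \<in> reached s ?par\<close> by (auto simp: reached_def)
    then obtain P where "apath s P y" "\<forall>e\<in>set P. par (head D e) = Some e"
      using tree by (auto simp: search_tree_def)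
    thus ?thesis using old by blast
  next
    case True
    obtain P where P: "apath s P (tail D e)" "\<forall>e\<in>set P. par (head D e) = Some e"
      using tree e(2) by (auto simp: search_tree_def)
    \<comment> \<open>Every vertex on \<open>P\<close> has been reached while
      \<open>head D e\<close> has not, so appending \<open>e\<close> repeats no vertex.\<close>
    have "set (awalk_verts s P) \<subseteq> reached s par"
      using P by (subst awalk_verts_conv'[of s P "tail D e"])
        (auto simp: apath_def awalk_def reached_def dest: hd_in_set split: if_splits elim: cas.elims)
    hence "head D e \<notin> set (awalk_verts s P)" using e(3) by auto
    moreover have "awlast s P = tail D e" using P(1) by (auto simp: apath_def)
    ultimately have "apath s (P @ [e]) (head D e)"
      using P(1) e(1) tail_neq_head[OF D e(1)] D head_in_V[OF D e(1)]
      by (auto simp: apath_append_iff apath_simps verts_orientation arcs_orientation)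
    moreover have "\<forall>e'\<in>set (P @ [e]). ?par (head D e') = Some e'" using P(2) old by auto
    ultimately show ?thesis using True by blast
  qed
qed

text \<open>Exactly the newly reached vertices are put on the list, so a scan leaves the set of
  processed vertices unchanged.\<close>

lemma scan_arcs_correct:
  assumes "scan_arcs D s x es par Q = ((par', Q'), t)" "set es \<subseteq> E"
    and "search_tree D s par" "x \<in> reached s par" "distinct Q" "set Q \<subseteq> reached s par"
  shows "search_tree D s par' \<and> t = Suc (length es) \<and> distinct Q' \<and>
    reached s par \<subseteq> reached s par' \<and> set Q' = set Q \<union> (reached s par' - reached s par) \<and>
    (\<forall>e\<in>set es. tail D e = x \<longrightarrow> head D e \<in> reached s par')"
  using assms
proof (induction es arbitrary: par Q t)
  case Nil
  thus ?case by auto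
next
  case (Cons e es)
  show ?case
  proof (cases "tail D e = x \<and> head D e \<noteq> s \<and> par (head D e) = None")
    case True
    let ?par = "par(head D e \<mapsto> e)" and ?Q = "head D e # Q"
    have new: "head D e \<notin> reached s par" using True by (auto simp: reached_def)
    have r: "reached s ?par = insert (head D e) (reached s par)" by (auto simp: reached_def)
    obtain t0 where t0: "scan_arcs D s x es ?par ?Q = ((par', Q'), t0)" "t = 1 + t0"
      using Cons.prems(1) True by (auto simp: Let_def split: prod.splits)
    have "search_tree D s ?par"
      using search_tree_update[OF Cons.prems(3)] new True Cons.prems by auto
    moreover have "x \<in> reached s ?par" "distinct ?Q" "set ?Q \<subseteq> reached s ?par" "set es \<subseteq> E"
      using Cons.prems new unfolding r by auto
    ultimately have "search_tree D s par' \<and> t0 = Suc (length es) \<and> distinct Q' \<and>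
        reached s ?par \<subseteq> reached s par' \<and> set Q' = set ?Q \<union> (reached s par' - reached s ?par) \<and>
        (\<forall>e\<in>set es. tail D e = x \<longrightarrow> head D e \<in> reached s par')"
      by (intro Cons.IH[OF t0(1)])
    thus ?thesis using t0(2) new unfolding r by auto
  next
    case False
    obtain t0 where t0: "scan_arcs D s x es par Q = ((par', Q'), t0)" "t = 1 + t0"
      using Cons.prems(1) False by (auto simp: Let_def split: prod.splits)
    have "search_tree D s par' \<and> t0 = Suc (length es) \<and> distinct Q' \<and>
        reached s par \<subseteq> reached s par' \<and> set Q' = set Q \<union> (reached s par' - reached s par) \<and>
        (\<forall>e\<in>set es. tail D e = x \<longrightarrow> head D e \<in> reached s par')"
      using Cons.IH[OF t0(1)] Cons.prems by auto
    moreover have "tail D e = x \<longrightarrow> head D e \<in> reached s par"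
      using False by (auto simp: reached_def)
    ultimately show ?thesis using t0(2) by auto
  qed
qed

text \<open>The vertices in \<open>reached s par - set Q\<close> are the processed ones.\<close>

lemma explore_correct:
  assumes "explore inc D s i par Q = (par', t)"
    and "search_tree D s par" "distinct Q" "set Q \<subseteq> reached s par"
    and "\<And>e. e \<in> E \<Longrightarrow> tail D e \<in> reached s par - set Q \<Longrightarrow> head D e \<in> reached s par"
    and "card (V - (reached s par - set Q)) \<le> i"
  shows "search_tree D s par' \<and>
    (\<forall>e\<in>E. tail D e \<in> reached s par' \<longrightarrow> head D e \<in> reached s par') \<and>
    t \<le> 1 + (\<Sum>y\<in>V - (reached s par - set Q). length (inc y) + 2)"
  using assms
proof (induction i arbitrary: par Q t)
  case 0
  \<comment> \<open>With no rounds left all vertices are processed, so the list is empty and the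
    reached set is closed.\<close>
  hence "V \<subseteq> reached s par - set Q" using finite_V by auto
  have "set Q = {}"
  proof (rule equals0I)
    fix q assume "q \<in> set Q"
    with \<open>set Q \<subseteq> _\<close> have "q \<in> reached s par" by (rule subsetD)
    hence "q \<in> V" using reached_subset[OF 0(2)] by auto
    with \<open>V \<subseteq> _\<close> have "q \<in> reached s par - set Q" by (rule subsetD)
    with \<open>q \<in> set Q\<close> show False by simp
  qed
  thus ?case using 0 by auto
next
  case (Suc i)
  show ?case
  proof (cases Q)
    case Nil
    thus ?thesis using Suc.prems by auto
  next
    case (Cons x R)
    obtain par1 Q1 t1 where scan: "scan_arcs D s x (inc x) par R = ((par1, Q1), t1)"
      by (metis prod.exhaust)
    obtain t2 where rest: "explore inc D s i par1 Q1 = (par', t2)" "t = 1 + t1 + t2"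
      using Suc.prems(1) scan Cons by (auto split: prod.splits)
    have x: "x \<in> reached s par" "x \<notin> set R" "x \<in> V"
      using Suc.prems(3,4) Cons reached_subset[OF Suc.prems(2)] by auto
    have inc: "set (inc x) \<subseteq> E" using set_inc[OF x(3)] by auto
    have 1: "search_tree D s par1" "t1 = Suc (length (inc x))" "distinct Q1"
      "reached s par \<subseteq> reached s par1" "set Q1 = set R \<union> (reached s par1 - reached s par)"
      "\<And>e. e \<in> set (inc x) \<Longrightarrow> tail D e = x \<Longrightarrow> head D e \<in> reached s par1"
      using scan_arcs_correct[OF scan inc Suc.prems(2) x(1)] Suc.prems(3,4) Cons by auto
    have processed: "reached s par1 - set Q1 = insert x (reached s par - set Q)"
      using 1(4,5) x Cons Suc.prems(4) by auto
    have card: "V - (reached s par - set Q) = insert x (V - insert x (reached s par - set Q))"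
      using x Cons by auto
    have "card (V - insert x (reached s par - set Q)) \<le> i"
      using Suc.prems(6) finite_V unfolding card by (subst (asm) card_insert_disjoint) auto
    moreover have "head D e \<in> reached s par1"
      if "e \<in> E" "tail D e \<in> insert x (reached s par - set Q)" for e
    proof (cases "tail D e = x")
      case True
      hence "e \<in> set (inc x)" using set_inc[OF x(3)] that(1) ends_orientation[OF D] by auto
      thus ?thesis using 1(6) True by blast
    next
      case False
      hence "tail D e \<in> reached s par - set Q" using that(2) by auto
      thus ?thesis using Suc.prems(5)[OF that(1)] 1(4) by blast
    qed
    moreover have "set Q1 \<subseteq> reached s par1" using 1(4,5) Suc.prems(4) Cons by auto
    ultimately have IH: "search_tree D s par' \<and>
        (\<forall>e\<in>E. tail D e \<in> reached s par' \<longrightarrow> head D e \<in> reached s par') \<and>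
        t2 \<le> 1 + (\<Sum>y\<in>V - insert x (reached s par - set Q). length (inc y) + 2)"
      using Suc.IH[OF rest(1) 1(1,3)] unfolding processed by blast
    \<comment> \<open>The summand of \<open>x\<close> pays for this round:
      \<open>Suc (length (inc x))\<close> for the scan and one further step.\<close>
    have "(\<Sum>y\<in>V - (reached s par - set Q). length (inc y) + 2) =
        length (inc x) + 2 + (\<Sum>y\<in>V - insert x (reached s par - set Q). length (inc y) + 2)"
      using finite_V by (subst card, subst sum.insert) auto
    thus ?thesis using IH rest(2) 1(2) by auto
  qed
qed

text \<open>Arcs are recovered from the end of the path, hence the induction on its last arc;
  \<open>R\<close> generalises over the arcs already collected.\<close>

lemma trace_back_correct:
  assumes "pre_digraph.apath D s P x" "\<forall>e\<in>set P. par (head D e) = Some e" "length P \<le> i"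
  shows "fst (trace_back D s par i x R) = P @ R"
  using assms
proof (induction P arbitrary: x i R rule: rev_induct)
  case Nil
  hence "x = s" by (auto simp: pre_digraph.apath_def pre_digraph.awalk_def pre_digraph.cas.simps)
  thus ?case by (cases i) auto
next
  case (snoc e P)
  interpret fin_digraph D by (rule fin_digraph_orientation[OF D])
  have P: "apath s P (tail D e)" "x = head D e"
    using snoc.prems(1) by (auto simp: apath_append_iff apath_simps)
  \<comment> \<open>The ends of a non-empty path differ, so the trace does not stop early.\<close>
  have "x \<noteq> s" using apath_nonempty_ends[OF snoc.prems(1)] by auto
  moreover obtain i' where i': "i = Suc i'" using snoc.prems(3) by (cases i) auto
  moreover have "fst (trace_back D s par i' (tail D e) (e # R)) = P @ e # R"
    using snoc.IH[OF P(1)] snoc.prems i' by auto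
  ultimately show ?case
    using snoc.prems(2) P(2) by (auto simp: Let_def split: prod.splits)
qed

lemma trace_back_time: "snd (trace_back D s par i x R) \<le> Suc i"
  by (induction D s par i x R rule: trace_back.induct)
    (auto simp: Let_def split: prod.splits option.splits)

text \<open>If \<open>x\<close> is not reached, the reached set is closed and serves as the cut. The
  time splits into initialisation, exploration and at most \<open>card V + 1\<close> steps of
  tracing back.\<close>

lemma find_path_correct:
  assumes "s \<noteq> x" "find_path vs inc D s x = (r, t)"
  shows "case r of
      None \<Rightarrow> \<exists>X\<subseteq>V. s \<in> X \<and> x \<notin> X \<and> outdeg_set D X = 0
    | Some P \<Rightarrow> pre_digraph.apath D s P x"
    and "t \<le> 4 * card V + 2 * card E + 3"
proof -
  interpret fin_digraph D by (rule fin_digraph_orientation[OF D])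
  obtain par t1 where ex: "explore inc D s (length vs) Map.empty [s] = (par, t1)"
    by (metis prod.exhaust)
  have tree: "search_tree D s par"
    and closed: "\<And>e. e \<in> E \<Longrightarrow> tail D e \<in> reached s par \<Longrightarrow> head D e \<in> reached s par"
    and t1: "t1 \<le> 1 + (2 * card E + 2 * card V)"
  proof -
    have r: "reached s Map.empty - set [s] = {}" by (auto simp: reached_def)
    have "search_tree D s par \<and>
        (\<forall>e\<in>E. tail D e \<in> reached s par \<longrightarrow> head D e \<in> reached s par) \<and>
        t1 \<le> 1 + (\<Sum>y\<in>V - {}. length (inc y) + 2)"
      by (rule explore_correct[OF ex search_tree_empty, unfolded r])
        (auto simp: reached_def length_vs)
    thus "search_tree D s par"
      and "\<And>e. e \<in> E \<Longrightarrow> tail D e \<in> reached s par \<Longrightarrow> head D e \<in> reached s par"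
      and "t1 \<le> 1 + (2 * card E + 2 * card V)"
      unfolding sum_length_inc Diff_empty by blast+
  qed
  have t: "t \<le> 1 + length vs + t1 + (length vs + 1)"
    using assms(2) ex trace_back_time[of par "length vs" x "[]"]
    by (auto simp: find_path_def Let_def split: prod.splits if_splits)
  thus "t \<le> 4 * card V + 2 * card E + 3" using t1 length_vs by simp
  show "case r of
      None \<Rightarrow> \<exists>X\<subseteq>V. s \<in> X \<and> x \<notin> X \<and> outdeg_set D X = 0
    | Some P \<Rightarrow> apath s P x"
  proof (cases "par x")
    case None
    hence "x \<notin> reached s par" using assms(1) by (auto simp: reached_def)
    moreover have "s \<in> reached s par" by (simp add: reached_def)
    moreover have "outdeg_set D (reached s par) = 0"
      using closed by (auto simp: outdeg_set_def arcs_orientation[OF D] card_eq_0_iff)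
    moreover have "r = None" using assms(2) ex None by (simp add: find_path_def)
    ultimately show ?thesis using reached_subset[OF tree] by auto
  next
    case (Some e)
    hence "x \<in> reached s par" by (auto simp: reached_def)
    then obtain P where P: "apath s P x" "\<forall>e\<in>set P. par (head D e) = Some e"
      using tree by (auto simp: search_tree_def)
    have "length P \<le> length vs"
      using length_apath[OF P(1)] by (simp add: length_vs verts_orientation[OF D])
    hence "fst (trace_back D s par (length vs) x []) = P" using trace_back_correct[OF P] by simp
    hence "r = Some P"
      using assms(2) ex Some by (auto simp: find_path_def split: prod.splits)
    thus ?thesis using P by simp
  qed
qed

end

section \<open>Testing flippability by repeated augmentation\<close>

lemma find_path_cut:
  assumes "orientation_of G D" "s \<in> V" "s \<noteq> x"
    and "\<And>X. X \<subseteq> V \<Longrightarrow> s \<in> X \<Longrightarrow> x \<notin> X \<Longrightarrow> 0 < outdeg_set D X"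
  shows "\<exists>P t. find_path vs inc D s x = (Some P, t) \<and> pre_digraph.apath D s P x"
proof -
  obtain r t where r: "find_path vs inc D s x = (r, t)" by (metis prod.exhaust)
  have "r \<noteq> None"
  proof
    assume "r = None"
    then obtain X where "X \<subseteq> V" "s \<in> X" "x \<notin> X" "outdeg_set D X = 0"
      using find_path_correct(1)[OF assms(1-3) r] by auto
    thus False using assms(4)[of X] by simp
  qed
  thus ?thesis using find_path_correct(1)[OF assms(1-3) r] r by auto
qed

text \<open>A failed path search exhibits a cut of value 0; a successful one lowers \<open>j\<close>
  and every separating cut by one. A round costs \<open>4 * card V + 2 * card E + 3\<close> for the
  path, at most \<open>card E + card V\<close> for the reversal, and one step.\<close>

lemma augment_correct:
  assumes "orientation_of G D" "s \<in> V" "s \<noteq> x"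
  shows "(fst (augment vs inc s x j D) \<longleftrightarrow>
      (\<forall>X\<subseteq>V. s \<in> X \<longrightarrow> x \<notin> X \<longrightarrow> j \<le> outdeg_set D X)) \<and>
    snd (augment vs inc s x j D) \<le> 1 + j * (5 * card V + 3 * card E + 4)"
  using assms(1)
proof (induction j arbitrary: D)
  case 0
  show ?case by simp
next
  case (Suc j)
  note D = Suc.prems
  interpret fin_digraph D by (rule fin_digraph_orientation[OF D])
  obtain r t where r: "find_path vs inc D s x = (r, t)" by (metis prod.exhaust)
  note path = find_path_correct[OF D assms(2,3) r]
  show ?case
  proof (cases r)
    case None
    then obtain X where "X \<subseteq> V" "s \<in> X" "x \<notin> X" "outdeg_set D X = 0" using path(1) by auto
    hence "\<not> (\<forall>X\<subseteq>V. s \<in> X \<longrightarrow> x \<notin> X \<longrightarrow> Suc j \<le> outdeg_set D X)"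
      by (metis not_less_eq_eq zero_le)
    moreover have "augment vs inc s x (Suc j) D = (False, 1 + t)" using r None by simp
    ultimately show ?thesis using path(2) by simp
  next
    case (Some P)
    hence P: "apath s P x" using path(1) by simp
    let ?D = "reverse_arcs D P"
    have D': "orientation_of G ?D" by (rule orientation_reverse_arcs[OF D])
    have "Suc (outdeg_set ?D X) = outdeg_set D X" if "X \<subseteq> V" "s \<in> X" "x \<notin> X" for X
      using outdeg_set_reverse_apath[OF D P that(1)] that by simp
    hence "(\<forall>X\<subseteq>V. s \<in> X \<longrightarrow> x \<notin> X \<longrightarrow> j \<le> outdeg_set ?D X) \<longleftrightarrow>
        (\<forall>X\<subseteq>V. s \<in> X \<longrightarrow> x \<notin> X \<longrightarrow> Suc j \<le> outdeg_set D X)"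
      by (metis Suc_le_mono)
    moreover have "length P \<le> card V"
      using length_apath[OF P] by (simp add: verts_orientation[OF D])
    moreover obtain b t' where aug: "augment vs inc s x j ?D = (b, t')" by (metis prod.exhaust)
    moreover have "augment vs inc s x (Suc j) D = (b, 1 + t + (card E + length P) + t')"
      using r Some aug by (simp add: reverse_path_def arcs_orientation[OF D])
    ultimately show ?thesis using Suc.IH[OF D'] path(2) by simp
  qed
qed

text \<open>Each of the \<open>card V\<close> candidates is charged \<open>Suc k\<close>
  augmentations and one path search; 5 collects the additive constants.\<close>

definition search_time :: "nat \<Rightarrow> nat" where
  "search_time k = 1 + card V * (5 + Suc k * (5 * card V + 3 * card E + 4) + 4 * card V + 2 * card E)"

text \<open>\<open>Suc k\<close> augmentations succeed iff all separating cuts exceed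
  \<open>k\<close>, which is flippability by \<open>flippable_iff_cuts\<close>; the subsequent path
  search then cannot fail.\<close>

lemma first_flippable_correct:
  assumes D: "orientation_of G D" and us: "set us \<subseteq> V"
    and pr: "\<And>u. u \<in> V \<Longrightarrow> u \<noteq> v \<Longrightarrow> fst (pr u) \<in> V \<and> snd (pr u) \<in> V \<and> fst (pr u) \<noteq> snd (pr u)"
  shows "case fst (first_flippable vs inc k pr D F v us) of
      None \<Rightarrow> \<forall>u\<in>set us - F. u \<noteq> v \<longrightarrow> \<not> flippable k D (fst (pr u)) (snd (pr u))
    | Some (u, P) \<Rightarrow> u \<in> set us - F \<and> u \<noteq> v \<and> flippable k D (fst (pr u)) (snd (pr u)) \<and>
        pre_digraph.apath D (fst (pr u)) P (snd (pr u))" (is "?correct us")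
    and "snd (first_flippable vs inc k pr D F v us) \<le>
      1 + length us * (5 + Suc k * (5 * card V + 3 * card E + 4) + 4 * card V + 2 * card E)" (is "?time us")
proof -
  have "?correct us \<and> ?time us"
    using us
  proof (induction us)
    case Nil
    show ?case by simp
  next
    case (Cons u us)
    obtain r t where rest: "first_flippable vs inc k pr D F v us = (r, t)" by (metis prod.exhaust)
    show ?case
    proof (cases "u \<in> F \<or> u = v")
      case True
      thus ?thesis using Cons rest by (auto split: option.splits)
    next
      case False
      obtain s x where sx: "pr u = (s, x)" by (metis prod.exhaust)
      have V: "s \<in> V" "x \<in> V" "s \<noteq> x" using pr[of u] Cons.prems False sx by auto
      obtain b t1 where aug: "augment vs inc s x (Suc k) D = (b, t1)" by (metis prod.exhaust)
      have b: "b \<longleftrightarrow> flippable k D s x"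
        using augment_correct[OF D V(1,3), of "Suc k"] flippable_iff_cuts[OF D V] aug
        by (simp add: Suc_le_eq)
      have t1: "t1 \<le> 1 + Suc k * (5 * card V + 3 * card E + 4)"
        using augment_correct[OF D V(1,3), of "Suc k"] aug by simp
      show ?thesis
      proof (cases b)
        case True
        hence "\<forall>X\<subseteq>V. s \<in> X \<longrightarrow> x \<notin> X \<longrightarrow> k < outdeg_set D X"
          using b flippable_iff_cuts[OF D V] by blast
        hence "\<exists>P t. find_path vs inc D s x = (Some P, t) \<and> pre_digraph.apath D s P x"
          using find_path_cut[OF D V(1,3)] by (metis gr_zeroI not_less_zero)
        then obtain P t2 where P: "find_path vs inc D s x = (Some P, t2)" "pre_digraph.apath D s P x"
          by blast
        have "t2 \<le> 4 * card V + 2 * card E + 3"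
          by (rule find_path_correct(2)[OF D V(1,3) P(1)])
        thus ?thesis using False sx aug True b t1 P by simp
      next
        case no: False
        show ?thesis using Cons rest False sx aug no b t1 by (auto split: option.splits)
      qed
    qed
  qed
  thus "?correct us" "?time us" by blast+
qed

lemma valid_search_minus: "valid_search_minus G k (search_minus vs inc k)"
  unfolding valid_search_minus_def
proof (intro allI impI)
  fix D F v assume *: "orientation_of G D \<and> k_connected k D \<and> F \<subseteq> V \<and> v \<in> V - F"
  show "case fst (search_minus vs inc k D F v) of
      None \<Rightarrow> \<not> (\<exists>u\<in>V - F. u \<noteq> v \<and> flippable k D v u)
    | Some (u, P) \<Rightarrow> u \<in> V - F \<and> u \<noteq> v \<and> flippable k D v u \<and> pre_digraph.apath D v P u"
  proof -
    have "case fst (search_minus vs inc k D F v) of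
        None \<Rightarrow> \<forall>u\<in>V - F. u \<noteq> v \<longrightarrow> \<not> flippable k D (fst (v, u)) (snd (v, u))
      | Some (u, P) \<Rightarrow> u \<in> V - F \<and> u \<noteq> v \<and> flippable k D (fst (v, u)) (snd (v, u)) \<and>
          pre_digraph.apath D (fst (v, u)) P (snd (v, u))"
      unfolding search_minus_def set_vs[symmetric]
      by (rule first_flippable_correct(1)) (use * set_vs in auto)
    thus ?thesis by (auto split: option.splits)
  qed
qed

lemma valid_search_plus: "valid_search_plus G k (search_plus vs inc k)"
  unfolding valid_search_plus_def
proof (intro allI impI)
  fix D F v assume *: "orientation_of G D \<and> k_connected k D \<and> F \<subseteq> V \<and> v \<in> V - F"
  show "case fst (search_plus vs inc k D F v) of
      None \<Rightarrow> \<not> (\<exists>u\<in>V - F. u \<noteq> v \<and> flippable k D u v)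
    | Some (u, P) \<Rightarrow> u \<in> V - F \<and> u \<noteq> v \<and> flippable k D u v \<and> pre_digraph.apath D u P v"
  proof -
    have "case fst (search_plus vs inc k D F v) of
        None \<Rightarrow> \<forall>u\<in>V - F. u \<noteq> v \<longrightarrow> \<not> flippable k D (fst (u, v)) (snd (u, v))
      | Some (u, P) \<Rightarrow> u \<in> V - F \<and> u \<noteq> v \<and> flippable k D (fst (u, v)) (snd (u, v)) \<and>
          pre_digraph.apath D (fst (u, v)) P (snd (u, v))"
      unfolding search_plus_def set_vs[symmetric]
      by (rule first_flippable_correct(1)) (use * set_vs in auto)
    thus ?thesis by (auto split: option.splits)
  qed
qed

lemma search_minus_time:
  assumes "orientation_of G D" "v \<in> V"
  shows "snd (search_minus vs inc k D F v) \<le> search_time k"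
  unfolding search_minus_def search_time_def length_vs[symmetric]
  by (rule first_flippable_correct(2)[unfolded length_vs[symmetric]]) (use assms set_vs in auto)

lemma search_plus_time:
  assumes "orientation_of G D" "v \<in> V"
  shows "snd (search_plus vs inc k D F v) \<le> search_time k"
  unfolding search_plus_def search_time_def length_vs[symmetric]
  by (rule first_flippable_correct(2)[unfolded length_vs[symmetric]]) (use assms set_vs in auto)

section \<open>Arithmetic of the delay bound\<close>

lemma search_time_le:
  assumes "1 \<le> k" "1 \<le> card V" "card V \<le> card E"
  shows "1 + search_time k + card E + card V \<le> 39 * (k * card V * card E)"
proof -
  let ?n = "card V" and ?m = "card E"
  have km: "?m \<le> k * ?m" "1 \<le> k * ?m" using assms by auto
  \<comment> \<open>\<open>Suc k\<close> is at most \<open>2 * k\<close>, and 12 = 5 + 3 + 4. Adding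
    5 + 4 + 2 to 24 gives the 35 below, and four further terms give the final 39.\<close>
  have "Suc k * (5 * ?n + 3 * ?m + 4) \<le> (2 * k) * (12 * ?m)"
    using assms by (intro mult_le_mono) auto
  also have "\<dots> = 24 * (k * ?m)" by simp
  finally have "5 + Suc k * (5 * ?n + 3 * ?m + 4) + 4 * ?n + 2 * ?m \<le> 35 * (k * ?m)"
    using km assms by linarith
  hence "?n * (5 + Suc k * (5 * ?n + 3 * ?m + 4) + 4 * ?n + 2 * ?m) \<le> ?n * (35 * (k * ?m))"
    by (rule mult_le_mono2)
  also have "\<dots> = 35 * (k * ?n * ?m)" by simp
  finally have "search_time k \<le> 1 + 35 * (k * ?n * ?m)" by (simp only: search_time_def add_le_cancel_left)
  moreover have "k * ?m \<le> k * ?n * ?m" using assms(2) by simp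
  ultimately show ?thesis using km assms(3) by linarith
qed

text \<open>Every vertex has outdegree at least \<open>k\<close>, and the outdegrees sum to
  \<open>card E\<close>. An edge guarantees a second vertex, so that \<open>{v}\<close> is a proper
  subset.\<close>

lemma card_le_of_k_connected:
  assumes D: "orientation_of G D" "k_connected k D" and "1 \<le> card E"
  shows "k * card V \<le> card E"
proof -
  have "k \<le> outdeg D v" if "v \<in> V" for v
    unfolding outdeg_def
  proof (rule k_connectedD[OF D])
    obtain e where "e \<in> E" using assms(3) by fastforce
    thus "{v} \<noteq> V" using tail_in_V[OF D(1), of e] head_in_V[OF D(1), of e] tail_neq_head[OF D(1), of e] by (metis singletonD)
  qed (use that in auto)
  hence "(\<Sum>v\<in>V. k) \<le> (\<Sum>v\<in>V. outdeg D v)" by (rule sum_mono)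
  thus ?thesis using sum_outdeg_V[OF D(1)] by (simp add: mult.commute)
qed

text \<open>Both alternatives of \<open>le\<close> give \<open>k * card V <= card E\<close>, which
  brings the initial time within the bound. The remaining work is \<open>gap_bound {}\<close>, where
  the degrees sum to \<open>2 * card E\<close>.\<close>

lemma delay_le_of_algorithm3:
  assumes init: "valid_initial G k init"
    and time: "snd init \<le> c * (k ^ 3 * card V ^ 3 + k * card V ^ 2 * card E)"
    and k: "1 \<le> k" "1 \<le> card E"
    and le: "(\<exists>D. orientation_of G D \<and> k_connected k D) \<or> k * card V \<le> card E"
    and tr: "algorithm3 vs (search_minus vs inc k) (search_plus vs inc k) init tr"
  shows "delay tr \<le> (210 + 2 * c) * (k * card V * card E ^ 2)"
proof -
  let ?n = "card V" and ?m = "card E"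
  have kn: "k * ?n \<le> ?m" using le card_le_of_k_connected k by blast
  have n: "1 \<le> ?n"
  proof -
    obtain e where "e \<in> E" using k(2) by fastforce
    hence "V \<noteq> {}" using ends_subset[of e] card_ends[of e] by auto
    thus ?thesis using finite_V by (simp add: Suc_le_eq card_gt_0_iff)
  qed
  have nm: "?n \<le> ?m" using kn k(1) by (metis le_trans mult_le_mono1 mult_1)
  let ?B = "k * ?n * ?m ^ 2"
  have mB: "?m \<le> ?B" and B: "1 \<le> ?B"
    using k n by (auto simp: power2_eq_square)
  \<comment> \<open>Two of the three factors \<open>k * ?n\<close> are estimated by
    \<open>?m\<close>.\<close>
  have "k ^ 3 * ?n ^ 3 = k * ?n * (k * ?n) ^ 2" by (simp add: power3_eq_cube power2_eq_square)
  also have "\<dots> \<le> ?B" using kn by (intro mult_le_mono power_mono) auto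
  finally have 1: "k ^ 3 * ?n ^ 3 \<le> ?B" .
  have "k * ?n ^ 2 * ?m = k * ?n * (?n * ?m)" by (simp add: power2_eq_square)
  also have "\<dots> \<le> ?B" using nm unfolding power2_eq_square by (intro mult_le_mono) auto
  finally have "snd init \<le> c * (?B + ?B)"
    using 1 by (intro order_trans[OF time] mult_le_mono2 add_mono)
  hence init_time: "snd init \<le> 2 * c * ?B" by (simp add: algebra_simps)
  define S where "S = 39 * (k * ?n * ?m)"
  interpret timed_search_procedures G k vs "search_minus vs inc k" "search_plus vs inc k" S
  proof unfold_locales
    have S: "1 + search_time k + ?m + ?n \<le> S"
      unfolding S_def by (rule search_time_le[OF k(1) n nm])
    fix D F v assume *: "orientation_of G D" "v \<in> V"
    show "1 + snd (search_minus vs inc k D F v) + ?m + ?n \<le> S"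
      and "1 + snd (search_plus vs inc k D F v) + ?m + ?n \<le> S"
      using search_minus_time[OF *, of k F] search_plus_time[OF *, of k F] S by linarith+
  qed (use valid_search_minus valid_search_plus set_vs length_vs in auto)
  have "gap_bound {} = 2 * ?m * S + 3 * ?n * S + ?n * (2 * ?n + 1) + (1 + 2 * ?n + ?m)"
  proof -
    have "(\<Sum>v\<in>V. (degree v + 3) * S + 2 * ?n + 1) = (\<Sum>v\<in>V. degree v * S + (3 * S + 2 * ?n + 1))"
      by (intro sum.cong) (simp_all add: algebra_simps)
    also have "\<dots> = 2 * ?m * S + ?n * (3 * S + 2 * ?n + 1)"
      by (simp only: sum.distrib sum_distrib_right[symmetric] sum_degrees sum_constant of_nat_id)
        (simp add: algebra_simps)
    finally show ?thesis by (simp add: gap_bound_def algebra_simps)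
  qed
  moreover have "3 * ?n * S \<le> 3 * ?m * S" using nm by simp
  moreover have "?n * (2 * ?n + 1) \<le> 3 * ?B"
  proof -
    have "?n * (2 * ?n + 1) \<le> (k * ?n) * (3 * ?m)" using nm n k by (intro mult_le_mono) auto
    also have "\<dots> \<le> 3 * ?B" using k(2) by (simp add: power2_eq_square)
    finally show ?thesis .
  qed
  moreover have "?m * S = 39 * ?B" by (simp add: S_def power2_eq_square)
  \<comment> \<open>202 = 2 * 39 + 3 * 39 + 3 + 4, the 4 coming from
    \<open>1 + 2 * ?n + ?m\<close>.\<close>
  ultimately have gap: "gap_bound {} \<le> 202 * ?B" using nm mB B by linarith
  have C: "(210 + 2 * c) * ?B = 210 * ?B + 2 * c * ?B" by (rule add_mult_distrib)
  show ?thesis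
    using tr
  proof cases
    case (no_orientation t)
    hence "delay tr = 1 + snd init" by (simp add: delay_def)
    thus ?thesis using init_time B unfolding C by linarith
  next
    case (orientation D tr' t)
    have "state D {}" using init orientation by (auto simp: valid_initial_def state_def)
    let ?M = "1 + t + ?n + gap_bound {}"
    have "gaps_within (1 + t + length vs) tr' ?M 0"
      using gaps_bounded(3)[OF orientation(3) \<open>state D {}\<close>] length_vs by simp
    hence "gaps_within 0 tr ?M 0" using orientation by (simp add: gaps_within_def)
    hence "delay tr \<le> ?M" by (rule delay_le)
    also have "t \<le> 2 * c * ?B" using init_time orientation by simp
    \<comment> \<open>As \<open>1\<close> and \<open>?n\<close> are each at most \<open>?B\<close>,
      the total is at most \<open>204 + 2 * c\<close> times \<open>?B\<close>.\<close>
    finally show ?thesis using gap B mB nm unfolding C by linarith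
  qed
qed

end

text \<open>Correctness covers arbitrary valid searches and every \<open>k\<close>; the delay refers
  to the implemented searches. For \<open>k = 0\<close> or \<open>m = 0\<close> the bound would be 0
  although steps are made, and without an orientation the only gap contains the whole initial
  computation, which \<open>k * n <= m\<close> keeps within the bound.\<close>

theorem theorem4:
  fixes c0 :: nat
  shows "\<exists>C::nat.
    \<forall>(G :: ('v, 'e) multigraph) (k :: nat) (n :: nat) (m :: nat)
      (vs :: 'v list) (inc :: 'v \<Rightarrow> 'e list) (init :: (('v, 'e) pre_digraph option) timed).
      loopless_multigraph G \<and> n = card (mverts G) \<and> m = card (medges G) \<and>
      adjacency_rep G vs inc \<and> valid_initial G k init \<longrightarrow>
        (\<forall>find_minus find_plus.
           valid_search_minus G k find_minus \<and> valid_search_plus G k find_plus \<longrightarrow>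
             (\<exists>tr. algorithm3 vs find_minus find_plus init tr) \<and>
             (\<forall>tr. algorithm3 vs find_minus find_plus init tr \<longrightarrow>
                distinct (outputs tr) \<and>
                set (outputs tr) = {\<alpha>. k_connected_outdeg_seq G k \<alpha>})) \<and>
        valid_search_minus G k (search_minus vs inc k) \<and>
        valid_search_plus G k (search_plus vs inc k) \<and>
        (snd init \<le> c0 * (k ^ 3 * n ^ 3 + k * n ^ 2 * m) \<and> k \<ge> 1 \<and> m \<ge> 1 \<and>
         ((\<exists>D. orientation_of G D \<and> k_connected k D) \<or> k * n \<le> m) \<longrightarrow>
           (\<forall>tr. algorithm3 vs (search_minus vs inc k) (search_plus vs inc k) init tr \<longrightarrow>
              delay tr \<le> C * (k * n * m ^ 2)))"
proof (rule exI[of _ "210 + 2 * c0"], intro allI impI, elim conjE, hypsubst)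
  fix G :: "('v, 'e) multigraph" and k :: nat and vs :: "'v list" and inc :: "'v \<Rightarrow> 'e list"
    and init :: "(('v, 'e) pre_digraph option) timed"
  assume "loopless_multigraph G" and adj: "adjacency_rep G vs inc" and init: "valid_initial G k init"
  then interpret adjacency_lists G vs inc by unfold_locales
  have "search_procedures G k vs find_minus find_plus"
    if "valid_search_minus G k find_minus" "valid_search_plus G k find_plus" for find_minus find_plus
    using that set_vs by unfold_locales
  note correct = search_procedures.algorithm3_correct[OF this init]
  show "(\<forall>find_minus find_plus.
      valid_search_minus G k find_minus \<and> valid_search_plus G k find_plus \<longrightarrow>
        (\<exists>tr. algorithm3 vs find_minus find_plus init tr) \<and>
        (\<forall>tr. algorithm3 vs find_minus find_plus init tr \<longrightarrow>
          distinct (outputs tr) \<and> set (outputs tr) = {\<alpha>. k_connected_outdeg_seq G k \<alpha>})) \<and>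
    valid_search_minus G k (search_minus vs inc k) \<and>
    valid_search_plus G k (search_plus vs inc k) \<and>
    (snd init \<le> c0 * (k ^ 3 * card V ^ 3 + k * card V ^ 2 * card E) \<and> k \<ge> 1 \<and> card E \<ge> 1 \<and>
      ((\<exists>D. orientation_of G D \<and> k_connected k D) \<or> k * card V \<le> card E) \<longrightarrow>
      (\<forall>tr. algorithm3 vs (search_minus vs inc k) (search_plus vs inc k) init tr \<longrightarrow>
        delay tr \<le> (210 + 2 * c0) * (k * card V * card E ^ 2)))"
    using correct valid_search_minus valid_search_plus delay_le_of_algorithm3[OF init]
    by (intro conjI allI impI) (auto; fail)+
qed

end
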